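(* Consider the sequence of models described in the context. Assume that the eigenvalues of $\boldsymbol\Sigma$ are bounded away from $0$ and $\infty$ (uniformly in $n$), that $n^{1/C_0}\le p\le n^{C_0}$ for some constant $C_0>0$, that $d_1\gg\sigma_n$, and that there are positive constants $c$ and $n_0$ such that $d_1/d_2\le 1+n^{-c}$ for all $n\ge n_0$. Then there exists a positive constant $C$ such that, as $n\to\infty$, $$\mathbb{P}\left(\frac{\widehat t_1}{\widehat t_2}\ge 1+C\left(\frac{1}{n^c}+\frac{\sigma_n}{d_1}\right)\right)\to 0 .$$
   Context: For each $n$, $\mathbf{X}=(\mathbf{x}_1,\dots,\mathbf{x}_n)$ is a $p\times n$ random matrix with $\mathbf{x}_i=Y_i\boldsymbol\mu_1+(1-Y_i)\boldsymbol\mu_2+\mathbf{w}_i$, where $Y_1,\dots,Y_n\in\{0,1\}$ are deterministic, $\boldsymbol\mu_1\ne\boldsymbol\mu_2$, $\boldsymbol\mu_2\neq0$ are deterministic vectors in $\mathbb{R}^p$, and $\mathbf{w}_1,\dots,\mathbf{w}_n$ are i.i.d. $\mathcal{N}(\mathbf{0},\boldsymbol\Sigma)$; $p,\boldsymbol\mu_1,\boldsymbol\mu_2,\boldsymbol\Sigma,Y_i$ may depend on $n$. Put $\sigma_n^2=\|\boldsymbol\Sigma\|^2(n+p)$ (spectral norm, $\sigma_n>0$). $d_1\ge d_2\ge0$ are the two largest singular values of $\mathbb{E}\mathbf{X}$ (which has rank at most 2), and $\widehat t_1\ge\widehat t_2\ge0$ are the two largest singular values of $\mathbf{X}$. For positive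 sequences, $u_n\gg v_n$ means $u_n/v_n\to\infty$. *)

theory Defs
  imports "HOL-Probability.Probability" "Jordan_Normal_Form.Char_Poly"
begin

text \<open>Library vectors and matrices of type \<^typ>\<open>real vec\<close> and \<^typ>\<open>real mat\<close> are those of
  Jordan_Normal_Form: the dimension is part of the value, so it may vary with the sample
  size. Indices start at 0. The infix symbols shared with HOL-Analysis are avoided in favour of
  \<^const>\<open>scalar_prod\<close> and \<^const>\<open>vec_index\<close>.\<close>

section \<open>Spectral norm and singular values\<close>

definition vec_l2_norm :: "real vec \<Rightarrow> real" where
  "vec_l2_norm v = sqrt (scalar_prod v v)"

definition spectral_norm :: "real mat \<Rightarrow> real" where
  "spectral_norm A =
     (SUP v \<in> {v \<in> carrier_vec (dim_col A). vec_l2_norm v \<le> 1}. vec_l2_norm (A *\<^sub>v v))"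

text \<open>Singular values are the square roots of the eigenvalues of \<open>A\<^sup>T A\<close>, counted with algebraic
  multiplicity and listed in decreasing order. If \<open>A\<close> has more columns than rows, the list
  is longer than the usual one, but only by zeros.\<close>

definition singular_values :: "real mat \<Rightarrow> real list" where
  "singular_values A =
     rev (sorted_list_of_multiset (image_mset sqrt (proots (char_poly (transpose_mat A * A)))))"

text \<open>The \<open>k\<close>-th largest singular value (\<open>k = 1, 2, \<dots>\<close>), with value 0 past the end of the list.\<close>

definition singular_value :: "real mat \<Rightarrow> nat \<Rightarrow> real" where
  "singular_value A k =
     (if 1 \<le> k \<and> k \<le> length (singular_values A) then singular_values A ! (k - 1) else 0)"

section \<open>Random vectors and matrices\<close>

text \<open>The Borel space of \<open>\<real>\<^sup>p\<close>, transported to vectors of dimension \<open>p\<close> along the coordinate map.\<close>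

definition vec_borel :: "nat \<Rightarrow> real vec measure" where
  "vec_borel p =
     vimage_algebra (carrier_vec p) (\<lambda>v. restrict (vec_index v) {..<p}) (\<Pi>\<^sub>M k\<in>{..<p}. borel)"

definition covariance_mat :: "nat \<Rightarrow> real mat \<Rightarrow> bool" where
  "covariance_mat p S \<longleftrightarrow>
     S \<in> carrier_mat p p \<and> transpose_mat S = S \<and>
     (\<forall>a \<in> carrier_vec p. 0 \<le> scalar_prod a (S *\<^sub>v a))"

text \<open>The law \<open>N(0, v)\<close> on the line with variance \<open>v\<close>, which is a point mass for \<open>v = 0\<close>.\<close>

definition centered_normal :: "real \<Rightarrow> real measure" where
  "centered_normal v =
     (if v = 0 then return borel 0 else density lborel (normal_density 0 (sqrt v)))"

text \<open>\<open>w\<close> has law \<open>N(0, S)\<close> in dimension \<open>p\<close>: every linear form of \<open>w\<close> is centered normal with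
  the variance prescribed by the covariance matrix \<open>S\<close>.\<close>

definition gaussian_vec :: "'a measure \<Rightarrow> nat \<Rightarrow> real mat \<Rightarrow> ('a \<Rightarrow> real vec) \<Rightarrow> bool" where
  "gaussian_vec M p S w \<longleftrightarrow>
     covariance_mat p S \<and> w \<in> measurable M (vec_borel p) \<and>
     (\<forall>a \<in> carrier_vec p.
        distr M borel (\<lambda>\<omega>. scalar_prod a (w \<omega>)) = centered_normal (scalar_prod a (S *\<^sub>v a)))"

definition iid_gaussian_vecs ::
  "'a measure \<Rightarrow> nat \<Rightarrow> nat \<Rightarrow> real mat \<Rightarrow> (nat \<Rightarrow> 'a \<Rightarrow> real vec) \<Rightarrow> bool" where
  "iid_gaussian_vecs M p n S w \<longleftrightarrow>
     (\<forall>i<n. gaussian_vec M p S (w i)) \<and>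
     prob_space.indep_vars M (\<lambda>_. vec_borel p) w {..<n}"

definition mat_expectation :: "'a measure \<Rightarrow> nat \<Rightarrow> nat \<Rightarrow> ('a \<Rightarrow> real mat) \<Rightarrow> real mat" where
  "mat_expectation M r c X = mat r c (\<lambda>ij. \<integral>\<omega>. X \<omega> $$ ij \<partial>M)"

text \<open>The \<open>p \<times> n\<close> matrix with columns \<open>y\<^sub>i m\<^sub>1 + (1 - y\<^sub>i) m\<^sub>2 + w\<^sub>i\<close>.\<close>

definition mixture_mat ::
  "nat \<Rightarrow> nat \<Rightarrow> (nat \<Rightarrow> real) \<Rightarrow> real vec \<Rightarrow> real vec \<Rightarrow> (nat \<Rightarrow> real vec) \<Rightarrow> real mat" where
  "mixture_mat p n y m1 m2 w =
     mat_of_cols p (map (\<lambda>i. y i \<cdot>\<^sub>v m1 + (1 - y i) \<cdot>\<^sub>v m2 + w i) [0..<n])"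

end

theory Submission
  imports Defs
begin

text \<open>The columns of \<open>X - E X\<close> are the Gaussian vectors, and by Weyl's inequalities the singular values of
  \<open>X\<close> differ from those of \<open>E X\<close> by at most the largest singular value of this noise matrix \<open>W\<close>. The
  latter is estimated on a finite net: for unit vectors \<open>a\<close>, \<open>b\<close> the form \<open>a \<bullet> W b\<close> is centered normal
  with variance at most \<open>\<parallel>\<Sigma>\<parallel>\<close>, and the net of pairs has at most \<open>2 ^ (18 (p + n))\<close> elements, so a
  Chernoff bound at level \<open>7 sqrt (\<parallel>\<Sigma>\<parallel> (n + p))\<close> beats the union bound. As \<open>\<parallel>\<Sigma>\<parallel>\<close> is bounded
  below, the noise is \<open>O(\<sigma>)\<close>, and the claim follows by dividing the two perturbation bounds.\<close>

text \<open>Singular values are defined through roots of a characteristic polynomial, whereas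
  perturbation and net arguments speak of norms. The bridge is an orthogonal diagonalisation of
  \<open>transpose_mat A * A\<close>, which yields extremal descriptions of the two largest singular
  values. One direction of perturbation per value suffices: the ratio becomes large only if the
  first singular value is too large or the second too small. Both bounds are proved off a single
  measurable event, and the event of the theorem is enclosed in it. Division is safe because the
  ratio hypothesis eventually gives d1 \<le> 2 d2, so that noise which is a small fraction of d1 is
  also a small fraction of d2. The noise scales with the square root of the norm of \<Sigma>, while
  \<sigma> contains the norm itself. The lower eigenvalue bound \<open>lo\<close> pays for the
  missing half power through sqrt V \<le> V / sqrt lo. No logarithm is lost, since the logarithm of
  the net size and the Gaussian exponent are both proportional to n + p.\<close>

unbundle no inner_syntax
unbundle no vec_syntax

subsection \<open>The Euclidean norm\<close>

lemma vec_l2_norm_eq_L2_set: "vec_l2_norm v = L2_set (vec_index v) {0..<dim_vec v}"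
  by (simp add: vec_l2_norm_def L2_set_def scalar_prod_def power2_eq_square)

lemma vec_l2_norm_nonneg [simp]: "0 \<le> vec_l2_norm v"
  by (simp add: vec_l2_norm_eq_L2_set)

lemma vec_l2_norm_sq: "(vec_l2_norm v)\<^sup>2 = v \<bullet> v"
  by (simp add: vec_l2_norm_def scalar_prod_def sum_nonneg)

lemma vec_l2_norm_eq_0_iff: "vec_l2_norm v = 0 \<longleftrightarrow> v = 0\<^sub>v (dim_vec v)"
proof -
  have "vec_l2_norm v = 0 \<longleftrightarrow> (\<forall>i\<in>{0..<dim_vec v}. v $ i = 0)"
    unfolding vec_l2_norm_eq_L2_set by (rule L2_set_eq_0_iff) simp
  also have "\<dots> \<longleftrightarrow> v = 0\<^sub>v (dim_vec v)"
    by (auto intro!: eq_vecI) (metis index_zero_vec(1))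
  finally show ?thesis .
qed

lemma vec_l2_norm_smult: "vec_l2_norm (c \<cdot>\<^sub>v v) = \<bar>c\<bar> * vec_l2_norm v"
proof (rule power2_eq_imp_eq)
  show "(vec_l2_norm (c \<cdot>\<^sub>v v))\<^sup>2 = (\<bar>c\<bar> * vec_l2_norm v)\<^sup>2"
    by (simp add: vec_l2_norm_sq power_mult_distrib) (simp add: power2_eq_square)
qed simp_all

lemma vec_l2_norm_add:
  assumes "dim_vec v = dim_vec w"
  shows "vec_l2_norm (v + w) \<le> vec_l2_norm v + vec_l2_norm w"
proof -
  have "L2_set (vec_index (v + w)) {0..<dim_vec w}
      = L2_set (\<lambda>i. v $ i + w $ i) {0..<dim_vec w}"
    by (rule L2_set_cong) auto
  then show ?thesis
    using L2_set_triangle_ineq[of "vec_index v" "vec_index w" "{0..<dim_vec w}"] assms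
    by (simp add: vec_l2_norm_eq_L2_set)
qed

lemma scalar_prod_le_l2_norms:
  assumes "dim_vec v = dim_vec w"
  shows "v \<bullet> w \<le> vec_l2_norm v * vec_l2_norm w"
proof -
  have "v \<bullet> w \<le> (\<Sum>i\<in>{0..<dim_vec w}. \<bar>v $ i\<bar> * \<bar>w $ i\<bar>)"
    unfolding scalar_prod_def by (intro sum_mono) (simp flip: abs_mult)
  also have "\<dots> \<le> vec_l2_norm v * vec_l2_norm w"
    using L2_set_mult_ineq[of "vec_index v" "vec_index w"] assms
    by (simp add: vec_l2_norm_eq_L2_set)
  finally show ?thesis .
qed

subsection \<open>Orthogonal diagonalisation\<close>

lemma symmetric_scalar_prod:
  fixes A :: "real mat"
  assumes "A \<in> carrier_mat n n" "transpose_mat A = A" "x \<in> carrier_vec n" "y \<in> carrier_vec n"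
  shows "y \<bullet> (A *\<^sub>v x) = x \<bullet> (A *\<^sub>v y)"
  using transpose_vec_mult_scalar[OF assms(1,3,4)] assms
  by (metis comm_scalar_prod mult_mat_vec_carrier)

text \<open>The characteristic polynomial has a complex root \<open>z\<close>. Writing an
  eigenvector as x + i y, symmetry equates \<open>y \<bullet> (A *\<^sub>v x)\<close> with
  \<open>x \<bullet> (A *\<^sub>v y)\<close>, which gives Im z (|x|^2 + |y|^2) = 0. Hence
  \<open>z\<close> is real, and whichever of \<open>x\<close>, \<open>y\<close> is nonzero is a real
  eigenvector.\<close>

lemma symmetric_real_eigenvalue:
  fixes A :: "real mat"
  assumes A: "A \<in> carrier_mat n n" and sym: "transpose_mat A = A" and n: "0 < n"
  shows "\<exists>e. eigenvalue A e"
proof -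
  let ?B = "map_mat complex_of_real A"
  have B: "?B \<in> carrier_mat n n" using A by simp
  have "degree (char_poly ?B) = n" using degree_monic_char_poly[OF B] by simp
  then have "\<not> constant (poly (char_poly ?B))"
    using n by (simp add: constant_degree)
  then obtain z where "poly (char_poly ?B) z = 0"
    using fundamental_theorem_of_algebra by blast
  then have "eigenvalue ?B z" using eigenvalue_root_char_poly[OF B] by simp
  then obtain v where v: "v \<in> carrier_vec n" "v \<noteq> 0\<^sub>v n" and Bv: "?B *\<^sub>v v = z \<cdot>\<^sub>v v"
    using A by (auto simp: eigenvalue_def eigenvector_def)
  define x y where "x = map_vec Re v" and "y = map_vec Im v"
  have x: "x \<in> carrier_vec n" and y: "y \<in> carrier_vec n" using v by (auto simp: x_def y_def)
  have entry: "(\<Sum>j\<in>{0..<n}. complex_of_real (A $$ (i,j)) * v $ j) = z * v $ i" if i: "i < n" for i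
  proof -
    have "(?B *\<^sub>v v) $ i = (\<Sum>j\<in>{0..<n}. complex_of_real (A $$ (i,j)) * v $ j)"
      using i A v by (auto simp: scalar_prod_def intro!: sum.cong)
    then show ?thesis using Bv i v by simp
  qed
  have Ax: "A *\<^sub>v x = Re z \<cdot>\<^sub>v x - Im z \<cdot>\<^sub>v y"
  proof (rule eq_vecI)
    fix i assume "i < dim_vec (Re z \<cdot>\<^sub>v x - Im z \<cdot>\<^sub>v y)"
    then have i: "i < n" using y by simp
    have "(A *\<^sub>v x) $ i = Re (\<Sum>j\<in>{0..<n}. complex_of_real (A $$ (i,j)) * v $ j)"
      using i A v by (auto simp: scalar_prod_def x_def intro!: sum.cong)
    also have "\<dots> = (Re z \<cdot>\<^sub>v x - Im z \<cdot>\<^sub>v y) $ i"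
      unfolding entry[OF i] using i v by (simp add: x_def y_def)
    finally show "(A *\<^sub>v x) $ i = (Re z \<cdot>\<^sub>v x - Im z \<cdot>\<^sub>v y) $ i" .
  qed (use A y in auto)
  have Ay: "A *\<^sub>v y = Re z \<cdot>\<^sub>v y + Im z \<cdot>\<^sub>v x"
  proof (rule eq_vecI)
    fix i assume "i < dim_vec (Re z \<cdot>\<^sub>v y + Im z \<cdot>\<^sub>v x)"
    then have i: "i < n" using x by simp
    have "(A *\<^sub>v y) $ i = Im (\<Sum>j\<in>{0..<n}. complex_of_real (A $$ (i,j)) * v $ j)"
      using i A v by (auto simp: scalar_prod_def y_def intro!: sum.cong)
    also have "\<dots> = (Re z \<cdot>\<^sub>v y + Im z \<cdot>\<^sub>v x) $ i"
      unfolding entry[OF i] using i v by (simp add: x_def y_def)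
    finally show "(A *\<^sub>v y) $ i = (Re z \<cdot>\<^sub>v y + Im z \<cdot>\<^sub>v x) $ i" .
  qed (use A x in auto)
  have "y \<bullet> (A *\<^sub>v x) = Re z * (y \<bullet> x) - Im z * (y \<bullet> y)"
    unfolding Ax using x y by (subst scalar_prod_minus_distrib[of _ n]) auto
  moreover have "x \<bullet> (A *\<^sub>v y) = Re z * (x \<bullet> y) + Im z * (x \<bullet> x)"
    unfolding Ay using x y by (subst scalar_prod_add_distrib[of _ n]) auto
  ultimately have "Im z * (x \<bullet> x + y \<bullet> y) = 0"
    using symmetric_scalar_prod[OF A sym x y] comm_scalar_prod[OF x y] by (simp add: algebra_simps)
  moreover have nz: "x \<noteq> 0\<^sub>v n \<or> y \<noteq> 0\<^sub>v n"
  proof (rule ccontr)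
    assume "\<not> (x \<noteq> 0\<^sub>v n \<or> y \<noteq> 0\<^sub>v n)"
    then have "Re (v $ i) = 0 \<and> Im (v $ i) = 0" if "i < n" for i
      using that v by (metis carrier_vecD index_map_vec(1) index_zero_vec(1) x_def y_def)
    then have "v = 0\<^sub>v n" using v by (intro eq_vecI) (auto simp: complex_eq_iff)
    then show False using v by simp
  qed
  moreover have "x \<bullet> x + y \<bullet> y \<noteq> 0"
  proof
    assume "x \<bullet> x + y \<bullet> y = 0"
    then have "vec_l2_norm x = 0" "vec_l2_norm y = 0"
      using vec_l2_norm_sq[of x] vec_l2_norm_sq[of y]
      by (metis sum_power2_eq_zero_iff)+
    then show False using nz x y by (simp add: vec_l2_norm_eq_0_iff)
  qed
  ultimately have "Im z = 0" by simp
  then have "A *\<^sub>v x = Re z \<cdot>\<^sub>v x" "A *\<^sub>v y = Re z \<cdot>\<^sub>v y"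
    unfolding Ax Ay using x y by (auto intro!: eq_vecI)
  then show ?thesis
    using nz x y A unfolding eigenvalue_def eigenvector_def by (metis carrier_matD(1))
qed

text \<open>For \<open>u = 0\<close> the division by zero makes this the identity, which is what \<open>householder_unit_vec\<close>
  needs when \<open>v\<close> is already the first unit vector.\<close>

definition householder :: "nat \<Rightarrow> real vec \<Rightarrow> real mat" where
  "householder n u = mat n n (\<lambda>(i,j). (if i = j then 1 else 0) - 2 / (u \<bullet> u) * u $ i * u $ j)"

lemma householder_carrier [simp]: "householder n u \<in> carrier_mat n n"
  by (simp add: householder_def)

lemma householder_symmetric: "transpose_mat (householder n u) = householder n u"
  by (rule eq_matI) (auto simp: householder_def)

lemma householder_involution:
  assumes u: "u \<in> carrier_vec n"
  shows "householder n u * householder n u = 1\<^sub>m n"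
proof (rule eq_matI)
  fix i j assume "i < dim_row (1\<^sub>m n :: real mat)" "j < dim_col (1\<^sub>m n :: real mat)"
  then have i: "i < n" and j: "j < n" by auto
  define c where "c = 2 / (u \<bullet> u)"
  have c: "c * c * (u \<bullet> u) = 2 * c" by (cases "u \<bullet> u = 0") (auto simp: c_def)
  have "(householder n u * householder n u) $$ (i,j)
      = (\<Sum>k\<in>{0..<n}. ((if i = k then 1 else 0) - c * u $ i * u $ k)
                     * ((if k = j then 1 else 0) - c * u $ k * u $ j))"
    using i j by (simp add: householder_def scalar_prod_def c_def)
  also have "\<dots> = (\<Sum>k\<in>{0..<n}. (if i = k then (if k = j then 1 else 0) else 0)
      - (if i = k then c * u $ k * u $ j else 0) - (if k = j then c * u $ i * u $ k else 0)
      + c * c * u $ i * u $ j * (u $ k * u $ k))"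
    by (intro sum.cong) (auto simp: algebra_simps)
  also have "\<dots> = (if i = j then 1 else 0) - 2 * c * u $ i * u $ j
      + c * c * u $ i * u $ j * (u \<bullet> u)"
    using i j u by (simp add: sum.distrib sum_subtractf sum_distrib_left scalar_prod_def)
  also have "\<dots> = (if i = j then 1 else 0) + u $ i * u $ j * (c * c * (u \<bullet> u) - 2 * c)"
    by (simp add: algebra_simps)
  finally show "(householder n u * householder n u) $$ (i,j) = 1\<^sub>m n $$ (i,j)"
    using i j c by simp
qed (auto simp: householder_def)

text \<open>A reflection along the difference of two vectors of equal length exchanges them. In
  coordinates this is the identity |u|^2 = 2 - 2 v0 = -2 u0 for u = v - e, where e is the first unit
  vector.\<close>

lemma householder_unit_vec:
  assumes v: "v \<in> carrier_vec (Suc m)" "v \<bullet> v = 1"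
  shows "householder (Suc m) (v - unit_vec (Suc m) 0) *\<^sub>v unit_vec (Suc m) 0 = v"
proof (rule eq_vecI)
  fix i assume "i < dim_vec v"
  then have i: "i < Suc m" using v by simp
  let ?e = "unit_vec (Suc m) 0 :: real vec"
  let ?u = "v - ?e"
  have "?u \<bullet> ?u = v \<bullet> v - 2 * (v $ 0) + 1"
    using v by (simp add: minus_scalar_prod_distrib[of _ "Suc m"] scalar_prod_minus_distrib[of _ "Suc m"])
  then have uu: "?u \<bullet> ?u = - 2 * ?u $ 0" using v by simp
  have main: "2 / (?u \<bullet> ?u) * ?u $ i * ?u $ 0 = - ?u $ i"
  proof (cases "?u \<bullet> ?u = 0")
    case True
    then have "vec_l2_norm ?u = 0" by (simp add: vec_l2_norm_def)
    then have "?u = 0\<^sub>v (Suc m)" using v by (simp add: vec_l2_norm_eq_0_iff)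
    then have "?u $ i = 0" using i by (metis index_zero_vec(1))
    then show ?thesis by simp
  next
    case False
    then have "?u $ 0 \<noteq> 0" using uu by force
    moreover have "2 / (- 2 * r) * s * r = - s" if "r \<noteq> 0" for r s :: real
      using that by simp
    ultimately show ?thesis unfolding uu by blast
  qed
  have "(householder (Suc m) ?u *\<^sub>v ?e) $ i = householder (Suc m) ?u $$ (i, 0)"
    using i householder_carrier[of "Suc m" ?u] by (simp del: householder_carrier)
  also have "\<dots> = (if i = 0 then 1 else 0) + ?u $ i"
    using i main by (simp add: householder_def)
  also have "\<dots> = v $ i" using i v by (simp add: unit_vec_def)
  finally show "(householder (Suc m) ?u *\<^sub>v ?e) $ i = v $ i" .
qed (use v in \<open>auto simp: householder_def\<close>)

text \<open>A Householder reflection that carries the first unit vector to a unit eigenvector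
  conjugates \<open>A\<close> into block form with the eigenvalue split off; the induction
  hypothesis handles the remaining symmetric block. The reflection replaces the completion of an
  eigenvector to an orthonormal basis.\<close>

theorem real_symmetric_diagonalisation:
  fixes A :: "real mat"
  assumes "A \<in> carrier_mat n n" "transpose_mat A = A"
  shows "\<exists>P d. P \<in> carrier_mat n n \<and> transpose_mat P * P = 1\<^sub>m n \<and>
    transpose_mat P * A * P = mat n n (\<lambda>(i,j). if i = j then d i else 0)"
  using assms
proof (induction n arbitrary: A)
  case 0
  then show ?case by (intro exI[of _ "1\<^sub>m 0"] exI) (auto intro!: eq_matI)
next
  case (Suc m)
  let ?n = "Suc m"
  note A = Suc.prems(1) and sym = Suc.prems(2)
  obtain e v0 where "v0 \<in> carrier_vec ?n" "v0 \<noteq> 0\<^sub>v ?n" and Av0: "A *\<^sub>v v0 = e \<cdot>\<^sub>v v0"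
    using symmetric_real_eigenvalue[OF A sym] A by (auto simp: eigenvalue_def eigenvector_def)
  define v where "v = (1 / vec_l2_norm v0) \<cdot>\<^sub>v v0"
  have "vec_l2_norm v0 \<noteq> 0"
    using \<open>v0 \<in> _\<close> \<open>v0 \<noteq> _\<close> by (simp add: vec_l2_norm_eq_0_iff)
  then have v: "v \<in> carrier_vec ?n" and vv: "v \<bullet> v = 1" and Av: "A *\<^sub>v v = e \<cdot>\<^sub>v v"
    using \<open>v0 \<in> _\<close> Av0 mult_mat_vec[OF A \<open>v0 \<in> _\<close>]
    by (auto simp: v_def smult_smult_assoc mult.commute vec_l2_norm_smult simp flip: vec_l2_norm_sq)
  let ?e = "unit_vec ?n 0 :: real vec"
  define H where "H = householder ?n (v - ?e)"
  have H: "H \<in> carrier_mat ?n ?n" and HT: "transpose_mat H = H" and HH: "H * H = 1\<^sub>m ?n"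
    and He: "H *\<^sub>v ?e = v"
    using v vv by (auto simp: H_def householder_symmetric householder_unit_vec
        intro!: householder_involution)
  have Hv: "H *\<^sub>v v = ?e"
    using H HH unfolding He[symmetric] by (simp flip: assoc_mult_mat_vec)
  define B where "B = H * A * H"
  have B: "B \<in> carrier_mat ?n ?n" using H A by (simp add: B_def)
  have BT: "transpose_mat B = B"
    unfolding B_def using H A HT sym
    by (simp add: transpose_mult[of _ ?n ?n _ ?n] assoc_mult_mat[of _ ?n ?n _ ?n _ ?n])
  have "B *\<^sub>v ?e = e \<cdot>\<^sub>v ?e"
    unfolding B_def using H A v He Av Hv
    by (simp add: assoc_mult_mat_vec[of _ ?n ?n _ ?n] mult_mat_vec[of _ ?n ?n])
  then have B0: "B $$ (i, 0) = (if i = 0 then e else 0)" if "i < ?n" for i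
  proof -
    have "B $$ (i, 0) = (B *\<^sub>v ?e) $ i" using that B by simp
    also have "\<dots> = (if i = 0 then e else 0)"
      unfolding \<open>B *\<^sub>v ?e = e \<cdot>\<^sub>v ?e\<close> using that by simp
    finally show ?thesis .
  qed
  \<comment> \<open>Symmetry carries the zeros of the first column over to the first row, so that
    \<open>B\<close> splits into diagonal blocks.\<close>
  have B0': "B $$ (0, i) = (if i = 0 then e else 0)" if "i < ?n" for i
    using B0[OF that] BT B that by (metis carrier_matD index_transpose_mat(1) zero_less_Suc)
  define A3 where "A3 = mat m m (\<lambda>(i,j). B $$ (Suc i, Suc j))"
  have A3: "A3 \<in> carrier_mat m m" by (simp add: A3_def)
  have A3T: "transpose_mat A3 = A3"
    using BT B by (intro eq_matI) (auto simp: A3_def, metis Suc_mono carrier_matD index_transpose_mat(1))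
  define E1 where "E1 = mat 1 1 (\<lambda>_. e)"
  have E1: "E1 \<in> carrier_mat 1 1" by (simp add: E1_def)
  have Bblock: "B = four_block_mat E1 (0\<^sub>m 1 m) (0\<^sub>m m 1) A3"
    using B B0 B0' by (intro eq_matI) (auto simp: E1_def A3_def)
  obtain P3 d where P3: "P3 \<in> carrier_mat m m" and P3P: "transpose_mat P3 * P3 = 1\<^sub>m m"
    and D3: "transpose_mat P3 * A3 * P3 = mat m m (\<lambda>(i,j). if i = j then d i else 0)"
    using Suc.IH[OF A3 A3T] by blast
  define Q where "Q = four_block_mat (1\<^sub>m 1) (0\<^sub>m 1 m) (0\<^sub>m m 1) P3"
  define QT where "QT = four_block_mat (1\<^sub>m 1) (0\<^sub>m 1 m) (0\<^sub>m m 1) (transpose_mat P3)"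
  have Q: "Q \<in> carrier_mat ?n ?n" and QTc: "QT \<in> carrier_mat ?n ?n" 
    using P3 four_block_carrier_mat[of "1\<^sub>m 1" 1 1 _ m m] by (auto simp: Q_def QT_def)
  have QT: "transpose_mat Q = QT"
    unfolding Q_def QT_def using P3 by (subst transpose_four_block_mat[of _ 1 1 _ m _ m]) auto
  have QQ: "QT * Q = 1\<^sub>m ?n"
    unfolding Q_def QT_def using P3 P3P
    by (subst mult_four_block_mat[of _ 1 1 _ m _ m _ _ 1 _ m]) auto
  have "QT * B = four_block_mat E1 (0\<^sub>m 1 m) (0\<^sub>m m 1) (transpose_mat P3 * A3)"
    unfolding QT_def Bblock using P3 A3 E1
    by (subst mult_four_block_mat[of _ 1 1 _ m _ m _ _ 1 _ m]) auto
  then have QBQ: "QT * B * Q = four_block_mat E1 (0\<^sub>m 1 m) (0\<^sub>m m 1) (transpose_mat P3 * A3 * P3)"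
    unfolding Q_def using P3 A3 E1
    by (simp, subst mult_four_block_mat[of _ 1 1 _ m _ m _ _ 1 _ m]) auto
  show ?case
  proof (intro exI conjI)
    let ?P = "H * Q" and ?d = "\<lambda>i. case i of 0 \<Rightarrow> e | Suc k \<Rightarrow> d k"
    show "?P \<in> carrier_mat ?n ?n" using H Q by simp
    have PT: "transpose_mat ?P = QT * H" using H Q HT QT by (simp add: transpose_mult[of _ ?n ?n _ ?n])
    have "transpose_mat ?P * ?P = QT * (H * H) * Q"
      unfolding PT using H Q QTc by (simp add: assoc_mult_mat[of _ ?n ?n _ ?n _ ?n])
    also have "\<dots> = 1\<^sub>m ?n" using HH QQ QTc by simp
    finally show "transpose_mat ?P * ?P = 1\<^sub>m ?n" .
    have "transpose_mat ?P * A * ?P = QT * B * Q"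
      unfolding PT B_def using H Q QTc A by (simp add: assoc_mult_mat[of _ ?n ?n _ ?n _ ?n])
    also have "\<dots> = mat ?n ?n (\<lambda>(i,j). if i = j then ?d i else 0)"
      unfolding QBQ D3 by (rule eq_matI) (auto simp: E1_def split: nat.splits)
    finally show "transpose_mat ?P * A * ?P = mat ?n ?n (\<lambda>(i,j). if i = j then ?d i else 0)" .
  qed
qed

subsection \<open>Singular values\<close>

text \<open>Reads off the eigenvalues, with multiplicity, from the factorised characteristic
  polynomial of a diagonal matrix.\<close>

lemma proots_prod_linear_factors:
  "proots (\<Prod>a\<leftarrow>as. [:- a, 1:]) = mset (as :: real list)"
proof (induction as)
  case (Cons a as)
  have "(\<Prod>a\<leftarrow>as. [:- a, 1:]) \<noteq> 0" by (auto simp: prod_list_zero_iff)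
  then have "proots ([:- a, 1:] * (\<Prod>a\<leftarrow>as. [:- a, 1:])) = {#a#} + mset as"
    using Cons by (subst proots_mult) (simp_all del: mult_pCons_left)
  then show ?case by (simp del: mult_pCons_left)
qed simp

text \<open>The right singular vectors are the columns of the orthogonal matrix that diagonalises
  \<open>transpose_mat A * A\<close>, rearranged to follow the decreasing list of singular values.
  The expansions concern the norms of \<open>x\<close> and of its image, which are the quantities
  compared in the extremal arguments.\<close>

lemma singular_value_decomposition:
  assumes A: "A \<in> carrier_mat m n"
  shows "\<exists>v. (\<forall>i<n. v i \<in> carrier_vec n) \<and>
    (\<forall>i<n. \<forall>j<n. v i \<bullet> v j = of_bool (i = j)) \<and>
    (\<forall>x\<in>carrier_vec n. x \<bullet> x = (\<Sum>i<n. (v i \<bullet> x)\<^sup>2)) \<and>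
    (\<forall>x\<in>carrier_vec n. (vec_l2_norm (A *\<^sub>v x))\<^sup>2
       = (\<Sum>i<n. (singular_values A ! i)\<^sup>2 * (v i \<bullet> x)\<^sup>2))"
    and length_singular_values: "length (singular_values A) = n"
    and singular_values_nonneg: "\<And>i. i < n \<Longrightarrow> 0 \<le> singular_values A ! i"
proof -
  define G where "G = transpose_mat A * A"
  have G: "G \<in> carrier_mat n n" and GT: "transpose_mat G = G"
    using A by (auto simp: G_def transpose_mult[of _ n m])
  obtain P d where P: "P \<in> carrier_mat n n" and PP: "transpose_mat P * P = 1\<^sub>m n"
    and D: "transpose_mat P * G * P = mat n n (\<lambda>(i,j). if i = j then d i else 0)"
    using real_symmetric_diagonalisation[OF G GT] by blast
  define D where "D = mat n n (\<lambda>(i,j). if i = j then d i else (0::real))"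
  have Dc: "D \<in> carrier_mat n n" by (simp add: D_def)
  have PT: "transpose_mat P \<in> carrier_mat n n" using P by simp
  have PP': "P * transpose_mat P = 1\<^sub>m n"
    using mat_mult_left_right_inverse[OF PT P PP] .
  have "P * D * transpose_mat P = (P * transpose_mat P) * G * (P * transpose_mat P)"
    using P PT G unfolding D_def D[symmetric] by (simp add: assoc_mult_mat[of _ n n _ n _ n])
  then have GD: "G = P * D * transpose_mat P" using PP' G by simp
  have norm_id: "x \<bullet> x = (\<Sum>i<n. (col P i \<bullet> x)\<^sup>2)" if x: "x \<in> carrier_vec n" for x
  proof -
    have "x = P *\<^sub>v (transpose_mat P *\<^sub>v x)"
      using x P PT PP' by (simp flip: assoc_mult_mat_vec)
    then have "x \<bullet> x = x \<bullet> (P *\<^sub>v (transpose_mat P *\<^sub>v x))" by simp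
    also have "\<dots> = (transpose_mat P *\<^sub>v x) \<bullet> (transpose_mat P *\<^sub>v x)"
      using x P PT by (subst transpose_vec_mult_scalar[OF P]) auto
    also have "\<dots> = (\<Sum>i<n. (col P i \<bullet> x)\<^sup>2)"
      using P x by (simp add: scalar_prod_def power2_eq_square lessThan_atLeast0)
    finally show ?thesis .
  qed
  have image_norm: "(vec_l2_norm (A *\<^sub>v x))\<^sup>2 = (\<Sum>i<n. d i * (col P i \<bullet> x)\<^sup>2)"
    if x: "x \<in> carrier_vec n" for x
  proof -
    have y: "transpose_mat P *\<^sub>v x \<in> carrier_vec n" using P x by simp
    have "(vec_l2_norm (A *\<^sub>v x))\<^sup>2 = (A *\<^sub>v x) \<bullet> (A *\<^sub>v x)" by (simp add: vec_l2_norm_sq)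
    also have "\<dots> = (transpose_mat A *\<^sub>v (A *\<^sub>v x)) \<bullet> x"
      using A x by (subst transpose_vec_mult_scalar[OF A]) auto
    also have "transpose_mat A *\<^sub>v (A *\<^sub>v x) = G *\<^sub>v x" using A x by (simp add: G_def)
    also have "(G *\<^sub>v x) \<bullet> x = x \<bullet> (G *\<^sub>v x)" using G x by (simp add: comm_scalar_prod[of _ n])
    also have "G *\<^sub>v x = P *\<^sub>v (D *\<^sub>v (transpose_mat P *\<^sub>v x))"
      unfolding GD using P Dc PT x by (simp add: assoc_mult_mat_vec[of _ n n _ n])
    also have "x \<bullet> (P *\<^sub>v (D *\<^sub>v (transpose_mat P *\<^sub>v x)))
        = (transpose_mat P *\<^sub>v x) \<bullet> (D *\<^sub>v (transpose_mat P *\<^sub>v x))"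
      using x P Dc y by (subst transpose_vec_mult_scalar[OF P]) auto
    also have "D *\<^sub>v (transpose_mat P *\<^sub>v x) = vec n (\<lambda>i. d i * (col P i \<bullet> x))"
    proof (rule eq_vecI)
      fix i assume "i < dim_vec (vec n (\<lambda>i. d i * (col P i \<bullet> x)))"
      then have i: "i < n" by simp
      have "(D *\<^sub>v (transpose_mat P *\<^sub>v x)) $ i
          = (\<Sum>j\<in>{0..<n}. (if i = j then d i else 0) * (col P j \<bullet> x))"
        using i P x by (auto simp: D_def scalar_prod_def)
      also have "\<dots> = (\<Sum>j\<in>{0..<n}. if i = j then d i * (col P j \<bullet> x) else 0)"
        by (intro sum.cong) auto
      finally show "(D *\<^sub>v (transpose_mat P *\<^sub>v x)) $ i = vec n (\<lambda>i. d i * (col P i \<bullet> x)) $ i"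
        using i by simp
    qed (simp add: D_def)
    also have "(transpose_mat P *\<^sub>v x) \<bullet> vec n (\<lambda>i. d i * (col P i \<bullet> x)) = (\<Sum>i<n. d i * (col P i \<bullet> x)\<^sup>2)"
      using P x by (simp add: scalar_prod_def[of _ "vec n _"] power2_eq_square lessThan_atLeast0 ac_simps)
    finally show ?thesis .
  qed
  have ortho: "col P i \<bullet> col P j = of_bool (i = j)" if "i < n" "j < n" for i j
  proof -
    have "col P i \<bullet> col P j = (transpose_mat P * P) $$ (i,j)" using that P by simp
    then show ?thesis unfolding PP using that by simp
  qed
  \<comment> \<open>Evaluating the expansion at the \<open>i\<close>-th column isolates
    \<open>d i\<close>. Nonnegativity is what later allows \<open>(sqrt (d i))\<^sup>2\<close> to be
    replaced by \<open>d i\<close>.\<close>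
  have d: "0 \<le> d i" if i: "i < n" for i
  proof -
    have "0 \<le> (vec_l2_norm (A *\<^sub>v col P i))\<^sup>2" by simp
    also have "\<dots> = (\<Sum>j<n. d j * (of_bool (j = i))\<^sup>2)"
      using P i by (subst image_norm) (auto simp: ortho intro!: sum.cong)
    also have "\<dots> = (\<Sum>j<n. if j = i then d j else 0)"
      by (intro sum.cong) auto
    finally show ?thesis using i by simp
  qed
  have "similar_mat G D"
    using P PT Dc G PP PP' GD by (intro similar_matI[of _ _ _ "transpose_mat P" n]) auto
  then have "char_poly G = char_poly D" by (rule char_poly_similar)
  also have "\<dots> = (\<Prod>a\<leftarrow>diag_mat D. [:- a, 1:])"
    by (rule char_poly_upper_triangular[OF Dc]) (auto simp: D_def upper_triangular_def)
  also have "diag_mat D = map d [0..<n]" by (simp add: diag_mat_def D_def)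
  finally have "proots (char_poly G) = mset (map d [0..<n])"
    by (simp only: proots_prod_linear_factors)
  then have mset_sv: "mset (singular_values A) = mset (map (\<lambda>i. sqrt (d i)) [0..<n])"
    by (simp add: singular_values_def G_def multiset.map_comp o_def flip: mset_map)
  then show len: "length (singular_values A) = n" by (metis mset_eq_length length_map length_upt diff_zero)
  \<comment> \<open>The diagonalisation produces the eigenvalues in arbitrary order, so equality of
    multisets gives the sorted list only up to a permutation.\<close>
  obtain \<pi> where \<pi>: "bij_betw \<pi> {..<n} {..<n}"
    and sv: "\<And>i. i < n \<Longrightarrow> singular_values A ! i = map (\<lambda>i. sqrt (d i)) [0..<n] ! \<pi> i"
  proof -
    obtain \<pi> where "\<pi> permutes {..<n}" "permute_list \<pi> (map (\<lambda>i. sqrt (d i)) [0..<n]) = singular_values A"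
      using mset_eq_permutation[OF mset_sv] by auto
    then show ?thesis
      using that[of \<pi>] permute_list_nth[of \<pi> "map (\<lambda>i. sqrt (d i)) [0..<n]"]
      by (auto simp: permutes_imp_bij)
  qed
  have \<pi>_less: "\<pi> i < n" if "i < n" for i using \<pi> that by (auto dest: bij_betwE)
  have sv: "singular_values A ! i = sqrt (d (\<pi> i))" if "i < n" for i
    using sv[OF that] \<pi>_less[OF that] by simp
  show "0 \<le> singular_values A ! i" if "i < n" for i
    using sv[OF that] d[OF \<pi>_less[OF that]] by simp
  show "\<exists>v. (\<forall>i<n. v i \<in> carrier_vec n) \<and>
    (\<forall>i<n. \<forall>j<n. v i \<bullet> v j = of_bool (i = j)) \<and>
    (\<forall>x\<in>carrier_vec n. x \<bullet> x = (\<Sum>i<n. (v i \<bullet> x)\<^sup>2)) \<and>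
    (\<forall>x\<in>carrier_vec n. (vec_l2_norm (A *\<^sub>v x))\<^sup>2
       = (\<Sum>i<n. (singular_values A ! i)\<^sup>2 * (v i \<bullet> x)\<^sup>2))"
  proof (intro exI[of _ "\<lambda>i. col P (\<pi> i)"] conjI allI impI ballI)
    fix i assume "i < n" then show "col P (\<pi> i) \<in> carrier_vec n" using P by (metis carrier_matD(1) col_dim)
  next
    fix i j assume "i < n" "j < n"
    then show "col P (\<pi> i) \<bullet> col P (\<pi> j) = of_bool (i = j)"
      using ortho[OF \<pi>_less \<pi>_less] \<pi> by (auto simp: bij_betw_def inj_on_def)
  next
    fix x :: "real vec" assume x: "x \<in> carrier_vec n"
    show "x \<bullet> x = (\<Sum>i<n. (col P (\<pi> i) \<bullet> x)\<^sup>2)"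
      unfolding norm_id[OF x] using sum.reindex_bij_betw[OF \<pi>, of "\<lambda>i. (col P i \<bullet> x)\<^sup>2"] by simp
    have "(vec_l2_norm (A *\<^sub>v x))\<^sup>2 = (\<Sum>i<n. d (\<pi> i) * (col P (\<pi> i) \<bullet> x)\<^sup>2)"
      unfolding image_norm[OF x]
      using sum.reindex_bij_betw[OF \<pi>, of "\<lambda>i. d i * (col P i \<bullet> x)\<^sup>2"] by simp
    also have "\<dots> = (\<Sum>i<n. (singular_values A ! i)\<^sup>2 * (col P (\<pi> i) \<bullet> x)\<^sup>2)"
      by (intro sum.cong) (auto simp: sv d \<pi>_less)
    finally show "(vec_l2_norm (A *\<^sub>v x))\<^sup>2
      = (\<Sum>i<n. (singular_values A ! i)\<^sup>2 * (col P (\<pi> i) \<bullet> x)\<^sup>2)" .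
  qed
qed

lemma singular_values_antimono:
  assumes "i \<le> j" "j < length (singular_values A)"
  shows "singular_values A ! j \<le> singular_values A ! i"
  using assms unfolding singular_values_def
  by (simp add: rev_nth sorted_nth_mono)

lemma singular_value_nonneg:
  assumes A: "A \<in> carrier_mat m n"
  shows "0 \<le> singular_value A k"
  using singular_values_nonneg[OF A, of "k - 1"] length_singular_values[OF A]
  by (auto simp: singular_value_def)

section \<open>Extremal characterisations of the two largest singular values\<close>

lemma singular_value_1_bound:
  assumes A: "A \<in> carrier_mat m n" and x: "x \<in> carrier_vec n"
  shows "vec_l2_norm (A *\<^sub>v x) \<le> singular_value A 1 * vec_l2_norm x"
proof (rule power2_le_imp_le)
  obtain v where v: "\<forall>x\<in>carrier_vec n. x \<bullet> x = (\<Sum>i<n. (v i \<bullet> x)\<^sup>2)"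
    "\<forall>x\<in>carrier_vec n. (vec_l2_norm (A *\<^sub>v x))\<^sup>2
       = (\<Sum>i<n. (singular_values A ! i)\<^sup>2 * (v i \<bullet> x)\<^sup>2)"
    using singular_value_decomposition[OF A] by blast
  have "(vec_l2_norm (A *\<^sub>v x))\<^sup>2 = (\<Sum>i<n. (singular_values A ! i)\<^sup>2 * (v i \<bullet> x)\<^sup>2)"
    using v x by blast
  also have "\<dots> \<le> (\<Sum>i<n. (singular_value A 1)\<^sup>2 * (v i \<bullet> x)\<^sup>2)"
    using length_singular_values[OF A] singular_values_nonneg[OF A]
    by (intro sum_mono mult_right_mono power_mono)
       (auto simp: singular_value_def intro!: singular_values_antimono)
  also have "\<dots> = (singular_value A 1)\<^sup>2 * (x \<bullet> x)" using v x by (simp add: sum_distrib_left)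
  finally show "(vec_l2_norm (A *\<^sub>v x))\<^sup>2 \<le> (singular_value A 1 * vec_l2_norm x)\<^sup>2"
    by (simp add: power_mult_distrib vec_l2_norm_sq)
qed (simp add: singular_value_nonneg[OF A])

lemma singular_value_1_attained:
  assumes A: "A \<in> carrier_mat m n" and n: "0 < n"
  shows "\<exists>x\<in>carrier_vec n. vec_l2_norm x = 1 \<and> vec_l2_norm (A *\<^sub>v x) = singular_value A 1"
proof -
  obtain v where v: "\<forall>i<n. v i \<in> carrier_vec n" "\<forall>i<n. \<forall>j<n. v i \<bullet> v j = of_bool (i = j)"
    "\<forall>x\<in>carrier_vec n. (vec_l2_norm (A *\<^sub>v x))\<^sup>2
       = (\<Sum>i<n. (singular_values A ! i)\<^sup>2 * (v i \<bullet> x)\<^sup>2)"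
    using singular_value_decomposition[OF A] by blast
  have "(vec_l2_norm (A *\<^sub>v v 0))\<^sup>2 = (\<Sum>i<n. (singular_values A ! i)\<^sup>2 * (v i \<bullet> v 0)\<^sup>2)"
    using v n by blast
  also have "\<dots> = (\<Sum>i<n. if i = 0 then (singular_values A ! i)\<^sup>2 else 0)"
    using v n by (intro sum.cong) auto
  also have "\<dots> = (singular_value A 1)\<^sup>2"
    using n length_singular_values[OF A] by (simp add: singular_value_def)
  finally have "vec_l2_norm (A *\<^sub>v v 0) = singular_value A 1"
    using singular_value_nonneg[OF A] by (simp add: power2_eq_iff_nonneg)
  moreover have "vec_l2_norm (v 0) = 1" using v n by (simp add: vec_l2_norm_def)
  ultimately show ?thesis using v n by blast
qed

text \<open>One half of the Courant-Fischer principle. The constraint vector is the first right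
  singular vector: orthogonality to it removes the leading term, and every remaining weight is at
  most the second singular value.\<close>

lemma singular_value_2_upper:
  assumes A: "A \<in> carrier_mat m n" and n: "2 \<le> n"
  shows "\<exists>u\<in>carrier_vec n. \<forall>x\<in>carrier_vec n. u \<bullet> x = 0 \<longrightarrow>
    vec_l2_norm (A *\<^sub>v x) \<le> singular_value A 2 * vec_l2_norm x"
proof -
  obtain v where v: "\<forall>i<n. v i \<in> carrier_vec n"
    "\<forall>x\<in>carrier_vec n. x \<bullet> x = (\<Sum>i<n. (v i \<bullet> x)\<^sup>2)"
    "\<forall>x\<in>carrier_vec n. (vec_l2_norm (A *\<^sub>v x))\<^sup>2
       = (\<Sum>i<n. (singular_values A ! i)\<^sup>2 * (v i \<bullet> x)\<^sup>2)"
    using singular_value_decomposition[OF A] by blast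
  have "vec_l2_norm (A *\<^sub>v x) \<le> singular_value A 2 * vec_l2_norm x"
    if x: "x \<in> carrier_vec n" "v 0 \<bullet> x = 0" for x
  proof (rule power2_le_imp_le)
    have "(vec_l2_norm (A *\<^sub>v x))\<^sup>2 = (\<Sum>i<n. (singular_values A ! i)\<^sup>2 * (v i \<bullet> x)\<^sup>2)"
      using v x by blast
    also have "\<dots> \<le> (\<Sum>i<n. (singular_value A 2)\<^sup>2 * (v i \<bullet> x)\<^sup>2)"
    proof (rule sum_mono)
      fix i assume i: "i \<in> {..<n}"
      show "(singular_values A ! i)\<^sup>2 * (v i \<bullet> x)\<^sup>2 \<le> (singular_value A 2)\<^sup>2 * (v i \<bullet> x)\<^sup>2"
      proof (cases "i = 0")
        case False
        then show ?thesis
          using i n length_singular_values[OF A] singular_values_nonneg[OF A]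
          by (intro mult_right_mono power_mono)
             (auto simp: singular_value_def intro!: singular_values_antimono)
      qed (simp add: x)
    qed
    also have "\<dots> = (singular_value A 2)\<^sup>2 * (x \<bullet> x)" using v x by (simp add: sum_distrib_left)
    finally show "(vec_l2_norm (A *\<^sub>v x))\<^sup>2 \<le> (singular_value A 2 * vec_l2_norm x)\<^sup>2"
      by (simp add: power_mult_distrib vec_l2_norm_sq)
  qed (simp add: singular_value_nonneg[OF A])
  then show ?thesis using v n by (intro bexI[of _ "v 0"]) auto
qed

text \<open>The other half of Courant-Fischer, by a dimension count: the plane spanned by the first
  two right singular vectors meets the hyperplane orthogonal to \<open>u\<close> in a nonzero
  vector, and on this plane both weights are at least the second singular value. The vector is left
  unnormalised, so its norm stays in the inequality.\<close>

lemma singular_value_2_lower: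
  assumes A: "A \<in> carrier_mat m n" and n: "2 \<le> n" and u: "u \<in> carrier_vec n"
  shows "\<exists>x\<in>carrier_vec n. vec_l2_norm x \<noteq> 0 \<and> u \<bullet> x = 0 \<and>
    singular_value A 2 * vec_l2_norm x \<le> vec_l2_norm (A *\<^sub>v x)"
proof -
  obtain v where v: "\<forall>i<n. v i \<in> carrier_vec n" "\<forall>i<n. \<forall>j<n. v i \<bullet> v j = of_bool (i = j)"
    "\<forall>x\<in>carrier_vec n. x \<bullet> x = (\<Sum>i<n. (v i \<bullet> x)\<^sup>2)"
    "\<forall>x\<in>carrier_vec n. (vec_l2_norm (A *\<^sub>v x))\<^sup>2
       = (\<Sum>i<n. (singular_values A ! i)\<^sup>2 * (v i \<bullet> x)\<^sup>2)"
    using singular_value_decomposition[OF A] by blast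
  \<comment> \<open>One linear equation in two unknowns. The standard solution vanishes when
    \<open>u\<close> is orthogonal to both singular vectors, hence the case split.\<close>
  obtain a b where ab: "a * (u \<bullet> v 0) + b * (u \<bullet> v 1) = 0" "a \<noteq> 0 \<or> b \<noteq> 0"
  proof (cases "u \<bullet> v 0 = 0 \<and> u \<bullet> v 1 = 0")
    case True then show ?thesis using that[of 1 0] by simp
  next
    case False then show ?thesis using that[of "u \<bullet> v 1" "- (u \<bullet> v 0)"] by auto
  qed
  define x where "x = a \<cdot>\<^sub>v v 0 + b \<cdot>\<^sub>v v 1"
  have v01: "v 0 \<in> carrier_vec n" "v 1 \<in> carrier_vec n" using v n by auto
  have x: "x \<in> carrier_vec n" using v01 by (simp add: x_def)
  have prod: "w \<bullet> x = a * (w \<bullet> v 0) + b * (w \<bullet> v 1)" if "w \<in> carrier_vec n" for w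
    unfolding x_def using that v01 by (subst scalar_prod_add_distrib[of _ n]) auto
  have vx: "v i \<bullet> x = (if i = 0 then a else if i = 1 then b else 0)" if "i < n" for i
    using that v n by (subst prod) auto
  have "x \<bullet> x = a * a + b * b"
    using n vx[of 0] vx[of 1] prod[OF x]
      comm_scalar_prod[OF x v01(1)] comm_scalar_prod[OF x v01(2)] by simp
  then have "vec_l2_norm x \<noteq> 0" using ab by (auto simp: vec_l2_norm_def sum_squares_eq_zero_iff)
  moreover have "u \<bullet> x = 0" using prod[OF u] ab by simp
  moreover have "singular_value A 2 * vec_l2_norm x \<le> vec_l2_norm (A *\<^sub>v x)"
  proof (rule power2_le_imp_le)
    have "(singular_value A 2 * vec_l2_norm x)\<^sup>2 = (\<Sum>i<n. (singular_value A 2)\<^sup>2 * (v i \<bullet> x)\<^sup>2)"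
      using v x by (simp add: power_mult_distrib vec_l2_norm_sq sum_distrib_left)
    also have "\<dots> \<le> (\<Sum>i<n. (singular_values A ! i)\<^sup>2 * (v i \<bullet> x)\<^sup>2)"
    proof (rule sum_mono)
      fix i assume "i \<in> {..<n}"
      then have i: "i < n" by simp
      show "(singular_value A 2)\<^sup>2 * (v i \<bullet> x)\<^sup>2 \<le> (singular_values A ! i)\<^sup>2 * (v i \<bullet> x)\<^sup>2"
      proof (cases "i \<le> 1")
        case True
        then show ?thesis
          using n length_singular_values[OF A] singular_value_nonneg[OF A, of 2]
          by (intro mult_right_mono power_mono)
             (auto simp: singular_value_def intro!: singular_values_antimono)
      qed (simp add: vx i)
    qed
    also have "\<dots> = (vec_l2_norm (A *\<^sub>v x))\<^sup>2" using v x by simp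
    finally show "(singular_value A 2 * vec_l2_norm x)\<^sup>2 \<le> (vec_l2_norm (A *\<^sub>v x))\<^sup>2" .
  qed simp
  ultimately show ?thesis using x by blast
qed

section \<open>Weyl's inequalities\<close>

theorem singular_value_1_perturbation:
  assumes A: "A \<in> carrier_mat m n" and B: "B \<in> carrier_mat m n" and n: "0 < n"
  shows "singular_value (A + B) 1 \<le> singular_value A 1 + singular_value B 1"
proof -
  have AB: "A + B \<in> carrier_mat m n" using B by simp
  obtain x where x: "x \<in> carrier_vec n" "vec_l2_norm x = 1"
    "vec_l2_norm ((A + B) *\<^sub>v x) = singular_value (A + B) 1"
    using singular_value_1_attained[OF AB n] by blast
  have "vec_l2_norm ((A + B) *\<^sub>v x) \<le> vec_l2_norm (A *\<^sub>v x) + vec_l2_norm (B *\<^sub>v x)"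
    using vec_l2_norm_add[of "A *\<^sub>v x" "B *\<^sub>v x"] A B x
    by (simp add: add_mult_distrib_mat_vec[of _ m n])
  then show ?thesis
    using singular_value_1_bound[OF A x(1)] singular_value_1_bound[OF B x(1)] x by simp
qed

text \<open>The constraint vector that is optimal for \<open>A + B\<close> is fed into the lower
  bound for \<open>A\<close>. This yields one test vector at which the second singular values of
  \<open>A\<close> and \<open>A + B\<close> can be compared, with the norm of \<open>B\<close> as
  the error.\<close>

theorem singular_value_2_perturbation:
  assumes A: "A \<in> carrier_mat m n" and B: "B \<in> carrier_mat m n" and n: "2 \<le> n"
  shows "singular_value A 2 \<le> singular_value (A + B) 2 + singular_value B 1"
proof -
  have AB: "A + B \<in> carrier_mat m n" using B by simp
  obtain u where u: "u \<in> carrier_vec n" "\<And>x. x \<in> carrier_vec n \<Longrightarrow> u \<bullet> x = 0 \<Longrightarrow>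
    vec_l2_norm ((A + B) *\<^sub>v x) \<le> singular_value (A + B) 2 * vec_l2_norm x"
    using singular_value_2_upper[OF AB n] by blast
  obtain x where x: "x \<in> carrier_vec n" "vec_l2_norm x \<noteq> 0" "u \<bullet> x = 0"
    "singular_value A 2 * vec_l2_norm x \<le> vec_l2_norm (A *\<^sub>v x)"
    using singular_value_2_lower[OF A n u(1)] by blast
  have "A *\<^sub>v x = (A + B) *\<^sub>v x + (- 1) \<cdot>\<^sub>v (B *\<^sub>v x)"
    using A B x by (simp add: add_mult_distrib_mat_vec[of _ m n]) (auto intro!: eq_vecI)
  then have "vec_l2_norm (A *\<^sub>v x) \<le> vec_l2_norm ((A + B) *\<^sub>v x) + vec_l2_norm (B *\<^sub>v x)"
    using vec_l2_norm_add[of "(A + B) *\<^sub>v x" "(- 1) \<cdot>\<^sub>v (B *\<^sub>v x)"] A B x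
    by (simp add: vec_l2_norm_smult)
  then have "singular_value A 2 * vec_l2_norm x
      \<le> (singular_value (A + B) 2 + singular_value B 1) * vec_l2_norm x"
    using u(2)[OF x(1,3)] singular_value_1_bound[OF B x(1)] x(4) by (simp add: distrib_right)
  then show ?thesis using x(2) vec_l2_norm_nonneg[of x] by (simp add: mult_le_cancel_right)
qed

subsection \<open>A net of the unit ball\<close>

text \<open>Grid points of mesh 1 / (4 sqrt d) inside the ball: \<open>d\<close> coordinate errors
  of at most one mesh width add up to Euclidean distance at most 1/4. The bound 16 d on the sum of
  the absolute values is spelled out because it is the form in which the points can be counted
  coordinate by coordinate.\<close>

definition unit_ball_net :: "nat \<Rightarrow> real vec set" where
  "unit_ball_net d =
     {u. \<exists>z \<in> {..<d} \<rightarrow>\<^sub>E (UNIV :: int set). (\<Sum>i<d. \<bar>z i\<bar>) \<le> 16 * int d \<and>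
        u = vec d (\<lambda>i. real_of_int (z i) / (4 * sqrt d)) \<and> vec_l2_norm u \<le> 1}"

lemma unit_ball_net_carrier: "u \<in> unit_ball_net d \<Longrightarrow> u \<in> carrier_vec d"
  and unit_ball_net_norm: "u \<in> unit_ball_net d \<Longrightarrow> vec_l2_norm u \<le> 1"
  unfolding unit_ball_net_def using vec_carrier by blast+

text \<open>A two-sided geometric sum. It stays below 4 = 2^2, which is how the weight 2^16 per
  coordinate becomes 2^18 in the cardinality bound.\<close>

lemma sum_half_power_abs:
  "(\<Sum>k\<in>{- int N..int N}. (1 / 2 :: real) ^ nat \<bar>k\<bar>) = 3 - 2 * (1 / 2) ^ N"
proof (induction N)
  case (Suc N)
  have "{- int (Suc N)..int (Suc N)}
      = insert (- int (Suc N)) (insert (int (Suc N)) {- int N..int N})" by auto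
  moreover have "nat \<bar>- int (Suc N)\<bar> = Suc N" "nat \<bar>int (Suc N)\<bar> = Suc N" by auto
  ultimately show ?case using Suc by (simp del: of_nat_Suc)
qed simp

text \<open>Each grid point \<open>z\<close> is counted with the weight \<open>2 ^ (16 d) * 2 ^ - (\<Sum>i<d. \<bar>z i\<bar>)\<close>, which is at
  least 1 on the grid and factorises over the coordinates.\<close>

lemma finite_card_int_grid:
  fixes d :: nat
  defines "Z \<equiv> {z \<in> {..<d} \<rightarrow>\<^sub>E (UNIV :: int set). (\<Sum>i<d. \<bar>z i\<bar>) \<le> 16 * int d}"
  shows "finite Z" and "card Z \<le> 2 ^ (18 * d)"
proof -
  define K where "K = {- int (16 * d)..int (16 * d)}"
  have sub: "Z \<subseteq> {..<d} \<rightarrow>\<^sub>E K"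
  proof
    fix z assume z: "z \<in> Z"
    have "\<bar>z i\<bar> \<le> 16 * int d" if "i < d" for i
      using z member_le_sum[of i "{..<d}" "\<lambda>i. \<bar>z i\<bar>"] that by (auto simp: Z_def)
    then show "z \<in> {..<d} \<rightarrow>\<^sub>E K"
      using z unfolding Z_def K_def by (auto simp: PiE_iff abs_le_iff minus_le_iff)
  qed
  have fin: "finite ({..<d} \<rightarrow>\<^sub>E K)" by (intro finite_PiE) (auto simp: K_def)
  then show finZ: "finite Z" using sub finite_subset by blast
  have weight: "1 \<le> (\<Prod>i<d. 2 ^ 16 * (1 / 2 :: real) ^ nat \<bar>z i\<bar>)" if z: "z \<in> Z" for z
  proof -
    have "int (\<Sum>i<d. nat \<bar>z i\<bar>) \<le> 16 * int d" using z by (simp add: Z_def)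
    then have le: "(\<Sum>i<d. nat \<bar>z i\<bar>) \<le> 16 * d" by linarith
    have "(2 :: real) ^ (\<Sum>i<d. nat \<bar>z i\<bar>) \<le> 2 ^ (16 * d)" using le by (rule power_increasing) simp
    then have "2 ^ (\<Sum>i<d. nat \<bar>z i\<bar>) * (1 / 2 :: real) ^ (\<Sum>i<d. nat \<bar>z i\<bar>)
        \<le> 2 ^ (16 * d) * (1 / 2) ^ (\<Sum>i<d. nat \<bar>z i\<bar>)"
      by (rule mult_right_mono) simp
    moreover have "2 ^ k * (1 / 2 :: real) ^ k = 1" for k
      by (simp flip: power_mult_distrib)
    moreover have "2 ^ (16 * d) * (1 / 2 :: real) ^ (\<Sum>i<d. nat \<bar>z i\<bar>)
        = (\<Prod>i<d. 2 ^ 16 * (1 / 2) ^ nat \<bar>z i\<bar>)"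
      by (simp only: prod.distrib prod_constant power_sum power_mult card_lessThan)
    ultimately show ?thesis by metis
  qed
  have "real (card Z) \<le> (\<Sum>z\<in>Z. \<Prod>i<d. 2 ^ 16 * (1 / 2 :: real) ^ nat \<bar>z i\<bar>)"
    using sum_mono[of Z "\<lambda>_. 1", OF weight] by simp
  \<comment> \<open>Passing from the grid to the surrounding box restores a product index set, over
    which the sum of products factorises.\<close>
  also have "\<dots> \<le> (\<Sum>z\<in>{..<d} \<rightarrow>\<^sub>E K. \<Prod>i<d. 2 ^ 16 * (1 / 2 :: real) ^ nat \<bar>z i\<bar>)"
    using fin sub by (intro sum_mono2 prod_nonneg) auto
  also have "\<dots> = (\<Prod>i<d. \<Sum>k\<in>K. 2 ^ 16 * (1 / 2 :: real) ^ nat \<bar>k\<bar>)"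
    by (rule prod_sum_PiE[symmetric]) (auto simp: K_def)
  also have "\<dots> = (2 ^ 16 * (3 - 2 * (1 / 2) ^ (16 * d))) ^ d"
    unfolding K_def sum_distrib_left[symmetric] sum_half_power_abs by simp
  also have "\<dots> \<le> (2 ^ 18) ^ d"
  proof (rule power_mono)
    have "2 ^ 16 * (3 - 2 * q) \<le> 2 ^ 18 \<and> 0 \<le> 2 ^ 16 * (3 - 2 * q)" if "0 \<le> q" "q \<le> 1" for q :: real
      using that by simp
    from this[of "(1 / 2) ^ (16 * d)"]
    show "2 ^ 16 * (3 - 2 * (1 / 2 :: real) ^ (16 * d)) \<le> 2 ^ 18"
      "0 \<le> 2 ^ 16 * (3 - 2 * (1 / 2 :: real) ^ (16 * d))"
      by (simp_all add: power_le_one)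
  qed
  finally have "real (card Z) \<le> real (2 ^ (18 * d))" by (simp add: power_mult)
  then show "card Z \<le> 2 ^ (18 * d)" by linarith
qed

lemma finite_unit_ball_net: "finite (unit_ball_net d)"
  and card_unit_ball_net: "card (unit_ball_net d) \<le> 2 ^ (18 * d)"
proof -
  let ?Z = "{z \<in> {..<d} \<rightarrow>\<^sub>E (UNIV :: int set). (\<Sum>i<d. \<bar>z i\<bar>) \<le> 16 * int d}"
  let ?f = "\<lambda>z. vec d (\<lambda>i. real_of_int (z i) / (4 * sqrt d))"
  have sub: "unit_ball_net d \<subseteq> ?f ` ?Z" by (auto simp: unit_ball_net_def)
  then show "finite (unit_ball_net d)"
    using finite_card_int_grid(1)[of d] finite_subset by blast
  have "card (unit_ball_net d) \<le> card (?f ` ?Z)"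
    using sub finite_card_int_grid(1)[of d] by (intro card_mono) auto
  also have "\<dots> \<le> card ?Z" using finite_card_int_grid(1)[of d] by (intro card_image_le) auto
  also have "\<dots> \<le> 2 ^ (18 * d)" by (rule finite_card_int_grid(2))
  finally show "card (unit_ball_net d) \<le> 2 ^ (18 * d)" .
qed

text \<open>Each coordinate is scaled by \<open>s\<close> and rounded to an integer, with an error
  of at most 1 / s after scaling back. The squared distance is then at most d / s^2 = 1/16.\<close>

lemma unit_ball_net_approx:
  assumes d: "0 < d" and u: "u \<in> carrier_vec d" "vec_l2_norm u \<le> 1"
  shows "\<exists>u'\<in>unit_ball_net d. vec_l2_norm (u - u') \<le> 1 / 4"
proof -
  define s where "s = 4 * sqrt (real d)"
  have s: "0 < s" "s\<^sup>2 = 16 * d" using d by (auto simp: s_def power_mult_distrib)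
  \<comment> \<open>Rounding towards zero keeps the approximation inside the ball.\<close>
  define r where "r x = (if 0 \<le> x then \<lfloor>x\<rfloor> else \<lceil>x\<rceil>)" for x :: real
  have r: "\<bar>real_of_int (r x)\<bar> \<le> \<bar>x\<bar>" "\<bar>x - real_of_int (r x)\<bar> \<le> 1" for x
    by (cases "0 \<le> x"; simp add: r_def; linarith)+
  define z where "z = restrict (\<lambda>i. r (s * u $ i)) {..<d}"
  define u' where "u' = vec d (\<lambda>i. real_of_int (z i) / s)"
  have u_sq: "(\<Sum>i<d. (u $ i)\<^sup>2) \<le> 1"
  proof -
    have "(\<Sum>i<d. (u $ i)\<^sup>2) = (vec_l2_norm u)\<^sup>2"
      using u unfolding vec_l2_norm_sq by (simp add: scalar_prod_def lessThan_atLeast0 power2_eq_square)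
    then show ?thesis using u by (simp add: power_le_one)
  qed
  have z_sq: "(real_of_int (z i))\<^sup>2 \<le> s\<^sup>2 * (u $ i)\<^sup>2" if "i < d" for i
    using r(1)[of "s * u $ i"] that by (simp add: z_def flip: power_mult_distrib abs_le_square_iff)
  have "(vec_l2_norm u')\<^sup>2 = (\<Sum>i<d. (real_of_int (z i))\<^sup>2 / s\<^sup>2)"
    unfolding vec_l2_norm_sq
    by (simp add: u'_def scalar_prod_def lessThan_atLeast0 power2_eq_square)
  also have "\<dots> \<le> (\<Sum>i<d. (u $ i)\<^sup>2)"
    using z_sq s(1) by (intro sum_mono) (simp add: divide_le_eq mult.commute)
  finally have "(vec_l2_norm u')\<^sup>2 \<le> 1\<^sup>2" using u_sq by simp
  then have u'_norm: "vec_l2_norm u' \<le> 1" by (rule power2_le_imp_le) simp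
  \<comment> \<open>Integrality is used here: it converts the bound on the sum of squares, s^2 = 16
    d, into the bound on the sum of absolute values that membership in the net demands.\<close>
  have abs_sq: "\<bar>k\<bar> \<le> k\<^sup>2" for k :: int
  proof (cases "k = 0")
    case False
    then have "1 \<le> \<bar>k\<bar>" by linarith
    from mult_left_mono[OF this, of "\<bar>k\<bar>"] show ?thesis by (simp add: power2_eq_square)
  qed simp
  have "real_of_int (\<Sum>i<d. \<bar>z i\<bar>) \<le> (\<Sum>i<d. s\<^sup>2 * (u $ i)\<^sup>2)"
    unfolding of_int_sum
  proof (rule sum_mono)
    fix i assume "i \<in> {..<d}"
    have "real_of_int \<bar>z i\<bar> \<le> real_of_int ((z i)\<^sup>2)" unfolding of_int_le_iff by (rule abs_sq)
    then show "real_of_int \<bar>z i\<bar> \<le> s\<^sup>2 * (u $ i)\<^sup>2" using z_sq[of i] \<open>i \<in> _\<close> by simp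
  qed
  also have "\<dots> = s\<^sup>2 * (\<Sum>i<d. (u $ i)\<^sup>2)" by (rule sum_distrib_left[symmetric])
  also have "\<dots> \<le> s\<^sup>2 * 1" by (intro mult_left_mono u_sq) simp
  also have "\<dots> = real_of_int (16 * int d)" using s by simp
  finally have "(\<Sum>i<d. \<bar>z i\<bar>) \<le> 16 * int d" by (simp only: of_int_le_iff)
  moreover have "z \<in> {..<d} \<rightarrow>\<^sub>E UNIV" by (simp add: z_def)
  moreover have "u' = vec d (\<lambda>i. real_of_int (z i) / (4 * sqrt d))" by (simp only: u'_def s_def)
  ultimately have "u' \<in> unit_ball_net d"
    unfolding unit_ball_net_def using u'_norm by blast
  moreover have "(vec_l2_norm (u - u'))\<^sup>2 \<le> (1 / 4)\<^sup>2"
  proof -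
    have "(vec_l2_norm (u - u'))\<^sup>2 = (\<Sum>i<d. (u $ i - real_of_int (z i) / s)\<^sup>2)"
      unfolding vec_l2_norm_sq
      by (simp add: u'_def scalar_prod_def lessThan_atLeast0 power2_eq_square)
    also have "\<dots> = (\<Sum>i<d. (s * u $ i - real_of_int (z i))\<^sup>2 / s\<^sup>2)"
    proof (intro sum.cong refl)
      fix i
      have "u $ i - real_of_int (z i) / s = (s * u $ i - real_of_int (z i)) / s"
        using s(1) by (simp add: field_simps)
      then show "(u $ i - real_of_int (z i) / s)\<^sup>2 = (s * u $ i - real_of_int (z i))\<^sup>2 / s\<^sup>2"
        by (simp only: power_divide)
    qed
    also have "\<dots> \<le> (\<Sum>i<d. 1 / s\<^sup>2)"
      using r(2) by (intro sum_mono divide_right_mono) (auto simp: z_def abs_square_le_1)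
    also have "\<dots> = (1 / 4)\<^sup>2" using d by (simp add: s(2)) (simp add: power2_eq_square)
    finally show ?thesis .
  qed
  then have "vec_l2_norm (u - u') \<le> 1 / 4" by (rule power2_le_imp_le) simp
  ultimately show ?thesis by blast
qed

text \<open>Let \<open>s\<close> be the largest singular value, attained at a unit vector
  \<open>x\<close> with normalised image \<open>y\<close>. Replacing \<open>x\<close> and then
  \<open>y\<close> by net points changes the bilinear form by at most s/4 each, so s \<le> T +
  s/2.\<close>

lemma singular_value_1_le_net:
  assumes W: "W \<in> carrier_mat p n" and pos: "0 < p" "0 < n" and T: "0 \<le> T"
    and net: "\<And>a b. a \<in> unit_ball_net p \<Longrightarrow> b \<in> unit_ball_net n \<Longrightarrow> a \<bullet> (W *\<^sub>v b) \<le> T"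
  shows "singular_value W 1 \<le> 2 * T"
proof (cases "singular_value W 1 = 0")
  case True then show ?thesis using T by simp
next
  case False
  define s where "s = singular_value W 1"
  have s: "0 < s" using False singular_value_nonneg[OF W, of 1] by (simp add: s_def)
  obtain x where x: "x \<in> carrier_vec n" "vec_l2_norm x = 1" "vec_l2_norm (W *\<^sub>v x) = s"
    using singular_value_1_attained[OF W pos(2)] by (auto simp: s_def)
  define y where "y = (1 / s) \<cdot>\<^sub>v (W *\<^sub>v x)"
  have y: "y \<in> carrier_vec p" "vec_l2_norm y = 1"
    using W x s by (auto simp: y_def vec_l2_norm_smult)
  have yWx: "y \<bullet> (W *\<^sub>v x) = s"
    using W x s by (simp add: y_def power2_eq_square flip: vec_l2_norm_sq)
  obtain x' where x': "x' \<in> unit_ball_net n" "vec_l2_norm (x - x') \<le> 1 / 4"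
    using unit_ball_net_approx[OF pos(2) x(1)] x by auto
  obtain y' where y': "y' \<in> unit_ball_net p" "vec_l2_norm (y - y') \<le> 1 / 4"
    using unit_ball_net_approx[OF pos(1) y(1)] y by auto
  note x'c = unit_ball_net_carrier[OF x'(1)] and y'c = unit_ball_net_carrier[OF y'(1)]
  have bilinear: "a \<bullet> (W *\<^sub>v b) \<le> vec_l2_norm a * (s * vec_l2_norm b)"
    if "a \<in> carrier_vec p" "b \<in> carrier_vec n" for a b
  proof -
    have "a \<bullet> (W *\<^sub>v b) \<le> vec_l2_norm a * vec_l2_norm (W *\<^sub>v b)"
      using that W by (intro scalar_prod_le_l2_norms) auto
    also have "\<dots> \<le> vec_l2_norm a * (s * vec_l2_norm b)"
      unfolding s_def by (intro mult_left_mono singular_value_1_bound[OF W that(2)]) simp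
    finally show ?thesis .
  qed
  have "s = y' \<bullet> (W *\<^sub>v x') + y' \<bullet> (W *\<^sub>v (x - x')) + (y - y') \<bullet> (W *\<^sub>v x)"
    unfolding yWx[symmetric] using x y x'c y'c W
    by (simp add: mult_minus_distrib_mat_vec[of _ p n] scalar_prod_minus_distrib[of _ p]
        minus_scalar_prod_distrib[of _ p])
  moreover have "y' \<bullet> (W *\<^sub>v x') \<le> T" using net x' y' by blast
  moreover have "y' \<bullet> (W *\<^sub>v (x - x')) \<le> 1 * (s * (1 / 4))"
  proof -
    have "y' \<bullet> (W *\<^sub>v (x - x')) \<le> vec_l2_norm y' * (s * vec_l2_norm (x - x'))"
      using x x'c y'c by (intro bilinear) auto
    also have "\<dots> \<le> 1 * (s * (1 / 4))"
      using x' s unit_ball_net_norm[OF y'(1)] by (intro mult_mono) auto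
    finally show ?thesis .
  qed
  moreover have "(y - y') \<bullet> (W *\<^sub>v x) \<le> 1 / 4 * (s * 1)"
  proof -
    have "(y - y') \<bullet> (W *\<^sub>v x) \<le> vec_l2_norm (y - y') * (s * vec_l2_norm x)"
      using x y y'c by (intro bilinear) auto
    also have "\<dots> \<le> 1 / 4 * (s * 1)"
      using x y' s by (intro mult_mono) auto
    finally show ?thesis .
  qed
  ultimately have "s \<le> 2 * T" by linarith
  then show ?thesis by (simp only: s_def)
qed

subsection \<open>Gaussian noise\<close>

text \<open>Stated for the extended nonnegative integral so that it feeds directly into the product
  formula for independent variables and the Chernoff inequality. The point mass at variance 0 obeys
  the same formula.\<close>

lemma nn_integral_exp_centered_normal:
  assumes v: "0 \<le> v"
  shows "(\<integral>\<^sup>+x. ennreal (exp (s * x)) \<partial>centered_normal v) = ennreal (exp (s\<^sup>2 * v / 2))"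
proof (cases "v = 0")
  case True
  then show ?thesis by (simp add: centered_normal_def nn_integral_return)
next
  case False
  then have v: "0 < v" using v by simp
  \<comment> \<open>completing the square\<close>
  have sq: "normal_density 0 (sqrt v) x * exp (s * x)
      = exp (s\<^sup>2 * v / 2) * normal_density (s * v) (sqrt v) x" for x
  proof -
    have "- x\<^sup>2 / (2 * v) + s * x = s\<^sup>2 * v / 2 - (x - s * v)\<^sup>2 / (2 * v)"
      using v by (simp add: field_simps power2_eq_square)
    then have "exp (- x\<^sup>2 / (2 * v)) * exp (s * x) = exp (s\<^sup>2 * v / 2) * exp (- (x - s * v)\<^sup>2 / (2 * v))"
      by (simp flip: exp_add)
    then show ?thesis using v by (simp add: normal_density_def)
  qed
  interpret N: prob_space "density lborel (normal_density (s * v) (sqrt v))"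
    using v by (intro prob_space_normal_density) simp
  have "(\<integral>\<^sup>+x. ennreal (exp (s * x)) \<partial>centered_normal v)
      = (\<integral>\<^sup>+x. ennreal (normal_density 0 (sqrt v) x) * ennreal (exp (s * x)) \<partial>lborel)"
    using v by (simp add: centered_normal_def nn_integral_density)
  also have "\<dots> = (\<integral>\<^sup>+x. ennreal (exp (s\<^sup>2 * v / 2)) * ennreal (normal_density (s * v) (sqrt v) x) \<partial>lborel)"
    by (intro nn_integral_cong) (simp add: sq flip: ennreal_mult)
  also have "\<dots> = ennreal (exp (s\<^sup>2 * v / 2)) * (\<integral>\<^sup>+x. normal_density (s * v) (sqrt v) x \<partial>lborel)"
    by (intro nn_integral_cmult) simp
  also have "(\<integral>\<^sup>+x. normal_density (s * v) (sqrt v) x \<partial>lborel) = 1"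
    using N.emeasure_space_1 by (simp add: emeasure_density)
  finally show ?thesis by simp
qed

text \<open>Serves to identify the expectation of the data matrix with the signal. Integrability is
  recorded together with the value because the Bochner integral is split into signal and
  noise.\<close>

lemma centered_normal_mean:
  assumes v: "0 \<le> v"
  shows "integrable (centered_normal v) (\<lambda>x. x)" and "(\<integral>x. x \<partial>centered_normal v) = 0"
proof -
  consider "v = 0" | "0 < v" using v by linarith
  then have "integrable (centered_normal v) (\<lambda>x. x) \<and> (\<integral>x. x \<partial>centered_normal v) = 0"
  proof cases
    case 1
    have "integrable (return borel (0::real)) (\<lambda>x. x)"
    proof (rule integrableI_bounded)
      show "(\<lambda>x. x) \<in> borel_measurable (return borel (0::real))"
        by (rule measurable_ident_sets) simp
      have "(\<integral>\<^sup>+x. ennreal (norm x) \<partial>return borel (0::real)) = ennreal (norm (0::real))"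
        by (rule nn_integral_return) auto
      then show "(\<integral>\<^sup>+x. ennreal (norm x) \<partial>return borel (0::real)) < \<infinity>" by (simp only: ennreal_less_top infinity_ennreal_def)
    qed
    moreover have "(\<integral>x. x \<partial>return borel (0::real)) = 0" by (rule integral_return) simp_all
    ultimately show ?thesis unfolding 1 centered_normal_def by simp
  next
    case 2
    then show ?thesis
      using normal_moment_nz_1[of "sqrt v" 0]
      by (simp add: centered_normal_def integrable_density integral_density
          has_bochner_integral_iff)
  qed
  then show "integrable (centered_normal v) (\<lambda>x. x)" "(\<integral>x. x \<partial>centered_normal v) = 0" by auto
qed

section \<open>Measurability of coordinates and linear forms\<close>

lemma space_vec_borel [simp]: "space (vec_borel p) = carrier_vec p"
  by (simp add: vec_borel_def)

lemma measurable_vec_index: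
  assumes "k < p"
  shows "(\<lambda>v. vec_index v k) \<in> borel_measurable (vec_borel p)"
proof -
  have "(\<lambda>v. restrict (vec_index v) {..<p}) \<in> vec_borel p \<rightarrow>\<^sub>M (\<Pi>\<^sub>M k\<in>{..<p}. borel)"
    unfolding vec_borel_def by (rule measurable_vimage_algebra1) (auto simp: space_PiM)
  from measurable_compose[OF this measurable_component_singleton[of k]]
  have "(\<lambda>v. restrict (vec_index v) {..<p} k) \<in> borel_measurable (vec_borel p)"
    using assms by simp
  then show ?thesis using assms by simp
qed

lemma measurable_scalar_prod:
  assumes "a \<in> carrier_vec p"
  shows "(\<lambda>v. a \<bullet> v) \<in> borel_measurable (vec_borel p)"
proof -
  have "(\<lambda>v. \<Sum>k\<in>{0..<p}. a $ k * v $ k) \<in> borel_measurable (vec_borel p)"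
    using measurable_vec_index[of _ p] by (intro borel_measurable_sum borel_measurable_times) auto
  then show ?thesis
    by (rule measurable_cong[THEN iffD1, rotated]) (simp add: scalar_prod_def)
qed

section \<open>The noise matrix and its bilinear forms\<close>

definition noise_mat :: "nat \<Rightarrow> nat \<Rightarrow> (nat \<Rightarrow> real vec) \<Rightarrow> real mat" where
  "noise_mat p n w = mat_of_cols p (map w [0..<n])"

lemma noise_mat_carrier [simp]: "noise_mat p n w \<in> carrier_mat p n"
  unfolding noise_mat_def using mat_of_cols_carrier(1)[of p "map w [0..<n]"] by simp

text \<open>Rewrites the bilinear form as a linear combination of the scalars
  \<open>a \<bullet> w i\<close>, one per column, which is the form in which independence of the
  columns can be used.\<close>

lemma scalar_prod_noise_mat:
  assumes "\<And>i. i < n \<Longrightarrow> w i \<in> carrier_vec p" "a \<in> carrier_vec p" "b \<in> carrier_vec n"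
  shows "a \<bullet> (noise_mat p n w *\<^sub>v b) = (\<Sum>i<n. b $ i * (a \<bullet> w i))"
proof -
  have "a \<bullet> (noise_mat p n w *\<^sub>v b) = (transpose_mat (noise_mat p n w) *\<^sub>v a) \<bullet> b"
    using assms by (subst transpose_vec_mult_scalar[of _ p n]) auto
  also have "\<dots> = (\<Sum>i<n. (col (noise_mat p n w) i \<bullet> a) * b $ i)"
    using assms carrier_matD[OF noise_mat_carrier[of p n w]]
    by (simp add: scalar_prod_def[of "_ *\<^sub>v _"] lessThan_atLeast0)
  also have "\<dots> = (\<Sum>i<n. b $ i * (a \<bullet> w i))"
    using assms by (intro sum.cong) (auto simp: noise_mat_def comm_scalar_prod[of a p])
  finally show ?thesis .
qed

context prob_space
begin

text \<open>Independence factorises the exponential over the columns, and each factor is the moment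
  generating function of \<open>a \<bullet> w i\<close> at \<open>s * b $ i\<close>. The exponents
  add up to that of a centered normal law with variance
  \<open>(b \<bullet> b) * (a \<bullet> (S *\<^sub>v a))\<close>.\<close>

lemma gaussian_bilinear_mgf:
  assumes w: "iid_gaussian_vecs M p n S w" and a: "a \<in> carrier_vec p" and b: "b \<in> carrier_vec n"
  shows "(\<integral>\<^sup>+\<omega>. ennreal (exp (s * (\<Sum>i<n. b $ i * (a \<bullet> w i \<omega>)))) \<partial>M)
    = ennreal (exp (s\<^sup>2 * (b \<bullet> b) * (a \<bullet> (S *\<^sub>v a)) / 2))"
proof -
  let ?q = "a \<bullet> (S *\<^sub>v a)"
  have gauss: "gaussian_vec M p S (w i)" if "i < n" for i
    using w that by (simp add: iid_gaussian_vecs_def)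
  have indep: "indep_vars (\<lambda>_. vec_borel p) w {..<n}"
    using w by (simp add: iid_gaussian_vecs_def)
  have meas: "(\<lambda>v. ennreal (exp (s * (b $ i * (a \<bullet> v))))) \<in> borel_measurable (vec_borel p)" for i
    using measurable_scalar_prod[OF a] by measurable
  have factor: "(\<integral>\<^sup>+\<omega>. ennreal (exp (s * (b $ i * (a \<bullet> w i \<omega>)))) \<partial>M)
      = ennreal (exp ((s * b $ i)\<^sup>2 * ?q / 2))" if i: "i < n" for i
  proof -
    have wi: "w i \<in> M \<rightarrow>\<^sub>M vec_borel p" and cov: "covariance_mat p S"
      and law: "distr M borel (\<lambda>\<omega>. a \<bullet> w i \<omega>) = centered_normal ?q"
      using gauss[OF i] a by (auto simp: gaussian_vec_def)
    have "(\<integral>\<^sup>+\<omega>. ennreal (exp (s * (b $ i * (a \<bullet> w i \<omega>)))) \<partial>M)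
        = (\<integral>\<^sup>+x. ennreal (exp ((s * b $ i) * x)) \<partial>distr M borel (\<lambda>\<omega>. a \<bullet> w i \<omega>))"
      using measurable_compose[OF wi measurable_scalar_prod[OF a]]
      by (subst nn_integral_distr) (auto simp: mult.assoc)
    also have "\<dots> = ennreal (exp ((s * b $ i)\<^sup>2 * ?q / 2))"
      unfolding law using cov a
      by (intro nn_integral_exp_centered_normal) (auto simp: covariance_mat_def)
    finally show ?thesis .
  qed
  have "(\<integral>\<^sup>+\<omega>. ennreal (exp (s * (\<Sum>i<n. b $ i * (a \<bullet> w i \<omega>)))) \<partial>M)
      = (\<integral>\<^sup>+\<omega>. (\<Prod>i<n. ennreal (exp (s * (b $ i * (a \<bullet> w i \<omega>))))) \<partial>M)"
    by (simp add: sum_distrib_left exp_sum prod_ennreal)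
  also have "\<dots> = (\<Prod>i<n. \<integral>\<^sup>+\<omega>. ennreal (exp (s * (b $ i * (a \<bullet> w i \<omega>)))) \<partial>M)"
    using indep_vars_compose2[OF indep meas] by (intro indep_vars_nn_integral) auto
  also have "\<dots> = (\<Prod>i<n. ennreal (exp ((s * b $ i)\<^sup>2 * ?q / 2)))"
    using factor by (intro prod.cong) auto
  also have "\<dots> = ennreal (exp (\<Sum>i<n. (s * b $ i)\<^sup>2 * ?q / 2))"
    by (simp add: prod_ennreal exp_sum)
  also have "(\<Sum>i<n. (s * b $ i)\<^sup>2 * ?q / 2) = s\<^sup>2 * (b \<bullet> b) * ?q / 2"
    using b by (simp add: scalar_prod_def[of b] lessThan_atLeast0 power_mult_distrib
        sum_distrib_left sum_distrib_right sum_divide_distrib power2_eq_square ac_simps)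
  finally show ?thesis .
qed

lemma measurable_gaussian_bilinear:
  assumes w: "iid_gaussian_vecs M p n S w" and a: "a \<in> carrier_vec p"
  shows "(\<lambda>\<omega>. \<Sum>i<n. b $ i * (a \<bullet> w i \<omega>)) \<in> borel_measurable M"
proof (intro borel_measurable_sum borel_measurable_times)
  fix i assume "i \<in> {..<n}"
  then have "w i \<in> M \<rightarrow>\<^sub>M vec_borel p"
    using w by (simp add: iid_gaussian_vecs_def gaussian_vec_def)
  then show "(\<lambda>\<omega>. a \<bullet> w i \<omega>) \<in> borel_measurable M"
    by (rule measurable_compose[OF _ measurable_scalar_prod[OF a]])
qed simp

lemma gaussian_bilinear_tail:
  assumes w: "iid_gaussian_vecs M p n S w" and a: "a \<in> carrier_vec p" and b: "b \<in> carrier_vec n"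
    and V: "0 < V" "a \<bullet> (S *\<^sub>v a) \<le> V" and b1: "b \<bullet> b \<le> 1" and T: "0 < T"
    and n: "0 < n"
  shows "prob {\<omega>\<in>space M. T \<le> (\<Sum>i<n. b $ i * (a \<bullet> w i \<omega>))} \<le> exp (- T\<^sup>2 / (2 * V))"
proof -
  let ?f = "\<lambda>\<omega>. \<Sum>i<n. b $ i * (a \<bullet> w i \<omega>)"
  \<comment> \<open>The minimiser of - s T + s^2 V / 2, the exponent in the Chernoff bound.\<close>
  define s where "s = T / V"
  have s: "0 < s" using V T by (simp add: s_def)
  have meas [measurable]: "?f \<in> borel_measurable M" by (rule measurable_gaussian_bilinear[OF w a])
  \<comment> \<open>Positivity of \<open>S\<close> is recorded with each column of the noise, so it
    is read off from an existing column.\<close>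
  have "covariance_mat p S" using w n by (auto simp: iid_gaussian_vecs_def gaussian_vec_def)
  then have q: "0 \<le> a \<bullet> (S *\<^sub>v a)" using a by (simp add: covariance_mat_def)
  have "(b \<bullet> b) * (a \<bullet> (S *\<^sub>v a)) \<le> 1 * V"
    using b1 V q by (intro mult_mono) auto
  then have "s\<^sup>2 * ((b \<bullet> b) * (a \<bullet> (S *\<^sub>v a))) / 2 \<le> s\<^sup>2 * V / 2"
    by (intro divide_right_mono mult_left_mono) auto
  then have mgf: "s\<^sup>2 * (b \<bullet> b) * (a \<bullet> (S *\<^sub>v a)) / 2 \<le> s\<^sup>2 * V / 2" by (simp add: mult.assoc)
  have "emeasure M {\<omega>\<in>space M. T \<le> ?f \<omega>}
      \<le> ennreal (exp (- s * T)) * (\<integral>\<^sup>+\<omega>. ennreal (exp (s * ?f \<omega>)) * indicator (space M) \<omega> \<partial>M)"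
    by (rule Chernoff_ineq_nn_integral_ge[OF s]) auto
  also have "(\<integral>\<^sup>+\<omega>. ennreal (exp (s * ?f \<omega>)) * indicator (space M) \<omega> \<partial>M)
      = (\<integral>\<^sup>+\<omega>. ennreal (exp (s * ?f \<omega>)) \<partial>M)"
    by (intro nn_integral_cong) simp
  also have "\<dots> = ennreal (exp (s\<^sup>2 * (b \<bullet> b) * (a \<bullet> (S *\<^sub>v a)) / 2))"
    by (rule gaussian_bilinear_mgf[OF w a b])
  also have "ennreal (exp (- s * T)) * \<dots> \<le> ennreal (exp (- s * T)) * ennreal (exp (s\<^sup>2 * V / 2))"
    using mgf by (intro mult_left_mono ennreal_leI) auto
  also have "\<dots> = ennreal (exp (- s * T + s\<^sup>2 * V / 2))"
    by (simp add: mult_exp_exp flip: ennreal_mult)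
  also have "- s * T + s\<^sup>2 * V / 2 = - T\<^sup>2 / (2 * V)"
    using V by (simp add: s_def field_simps power2_eq_square)
  finally show ?thesis by (simp add: emeasure_eq_measure)
qed

text \<open>The exceptional event is a finite union over net pairs of threshold events for linear
  forms of the noise, hence measurable. Bounding the singular value off this event keeps the measure
  theory at the level of real random variables.\<close>

theorem gaussian_noise_singular_value_tail:
  assumes w: "iid_gaussian_vecs M p n S w" and pos: "0 < p" "0 < n"
    and V: "0 < V" "\<And>a. a \<in> carrier_vec p \<Longrightarrow> vec_l2_norm a \<le> 1 \<Longrightarrow> a \<bullet> (S *\<^sub>v a) \<le> V"
    and T: "0 < T"
  shows "\<exists>A\<in>events. prob A \<le> 2 ^ (18 * (p + n)) * exp (- T\<^sup>2 / (2 * V)) \<and>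
    (\<forall>\<omega>\<in>space M - A. singular_value (noise_mat p n (\<lambda>i. w i \<omega>)) 1 \<le> 2 * T)"
proof -
  define B where "B ab = {\<omega>\<in>space M. T \<le> (\<Sum>i<n. snd ab $ i * (fst ab \<bullet> w i \<omega>))}" for ab
  define N where "N = unit_ball_net p \<times> unit_ball_net n"
  define A where "A = (\<Union>ab\<in>N. B ab)"
  have N: "finite N" by (simp add: N_def finite_unit_ball_net)
  have BM: "B ab \<in> events" if "ab \<in> N" for ab
    using that measurable_gaussian_bilinear[OF w, of "fst ab" "snd ab"] unit_ball_net_carrier
    unfolding B_def N_def by (intro borel_measurable_le) auto
  have prob_B: "prob (B ab) \<le> exp (- T\<^sup>2 / (2 * V))" if ab: "ab \<in> N" for ab
  proof -
    have a: "fst ab \<in> carrier_vec p" "vec_l2_norm (fst ab) \<le> 1"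
      and b: "snd ab \<in> carrier_vec n" "vec_l2_norm (snd ab) \<le> 1"
      using ab unit_ball_net_carrier unit_ball_net_norm by (auto simp: N_def)
    have "snd ab \<bullet> snd ab \<le> 1" using b(2) by (simp add: power_le_one flip: vec_l2_norm_sq)
    then show ?thesis
      unfolding B_def using gaussian_bilinear_tail[OF w a(1) b(1) V(1) V(2)[OF a]] T pos by simp
  qed
  have AM: "A \<in> events" unfolding A_def using N BM by blast
  have "prob A \<le> (\<Sum>ab\<in>N. prob (B ab))"
    unfolding A_def using N BM by (intro finite_measure_subadditive_finite) auto
  also have "\<dots> \<le> (\<Sum>ab\<in>N. exp (- T\<^sup>2 / (2 * V)))" using prob_B by (rule sum_mono)
  also have "\<dots> = real (card N) * exp (- T\<^sup>2 / (2 * V))" by simp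
  also have "\<dots> \<le> 2 ^ (18 * (p + n)) * exp (- T\<^sup>2 / (2 * V))"
  proof (rule mult_right_mono)
    have "card N \<le> 2 ^ (18 * p) * 2 ^ (18 * n)"
      unfolding N_def card_cartesian_product by (intro mult_mono card_unit_ball_net) auto
    then have "card N \<le> 2 ^ (18 * (p + n))" by (simp add: power_add distrib_left)
    then have "real (card N) \<le> real (2 ^ (18 * (p + n)))" by (simp only: of_nat_le_iff)
    then show "real (card N) \<le> 2 ^ (18 * (p + n))" by simp
  qed simp
  finally have probA: "prob A \<le> 2 ^ (18 * (p + n)) * exp (- T\<^sup>2 / (2 * V))" .
  have "singular_value (noise_mat p n (\<lambda>i. w i \<omega>)) 1 \<le> 2 * T" if \<omega>: "\<omega> \<in> space M - A" for \<omega>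
  proof (rule singular_value_1_le_net[OF noise_mat_carrier pos])
    show "0 \<le> T" using T by simp
    fix a b assume ab: "a \<in> unit_ball_net p" "b \<in> unit_ball_net n"
    have "w i \<omega> \<in> carrier_vec p" if "i < n" for i
    proof -
      have "w i \<in> M \<rightarrow>\<^sub>M vec_borel p"
        using w that by (simp add: iid_gaussian_vecs_def gaussian_vec_def)
      then show ?thesis using \<omega> measurable_space[of "w i" M "vec_borel p" \<omega>] by simp
    qed
    then have "a \<bullet> (noise_mat p n (\<lambda>i. w i \<omega>) *\<^sub>v b) = (\<Sum>i<n. b $ i * (a \<bullet> w i \<omega>))"
      using ab by (intro scalar_prod_noise_mat) (auto dest: unit_ball_net_carrier)
    moreover have "\<omega> \<notin> B (a, b)" using \<omega> ab by (auto simp: A_def N_def)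
    ultimately show "a \<bullet> (noise_mat p n (\<lambda>i. w i \<omega>) *\<^sub>v b) \<le> T" using \<omega> by (simp add: B_def)
  qed
  then show ?thesis using AM probA by blast
qed

end

subsection \<open>The spectral norm\<close>

text \<open>A real supremum dominates its elements only when the set is bounded above; the largest
  singular value provides the bound.\<close>

lemma vec_l2_norm_le_spectral_norm:
  assumes S: "S \<in> carrier_mat p n" and a: "a \<in> carrier_vec n" "vec_l2_norm a \<le> 1"
  shows "vec_l2_norm (S *\<^sub>v a) \<le> spectral_norm S"
  unfolding spectral_norm_def
proof (rule cSUP_upper)
  show "a \<in> {v \<in> carrier_vec (dim_col S). vec_l2_norm v \<le> 1}" using S a by simp
  show "bdd_above ((\<lambda>v. vec_l2_norm (S *\<^sub>v v)) ` {v \<in> carrier_vec (dim_col S). vec_l2_norm v \<le> 1})"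
  proof (rule bdd_aboveI2)
    fix v assume v: "v \<in> {v \<in> carrier_vec (dim_col S). vec_l2_norm v \<le> 1}"
    have "vec_l2_norm (S *\<^sub>v v) \<le> singular_value S 1 * vec_l2_norm v"
      using singular_value_1_bound[OF S] v S by simp
    also have "\<dots> \<le> singular_value S 1 * 1"
      using v by (intro mult_left_mono singular_value_nonneg[OF S]) auto
    finally show "vec_l2_norm (S *\<^sub>v v) \<le> singular_value S 1" by simp
  qed
qed

lemma quadratic_form_le_spectral_norm:
  assumes S: "S \<in> carrier_mat p p" and a: "a \<in> carrier_vec p" "vec_l2_norm a \<le> 1"
  shows "a \<bullet> (S *\<^sub>v a) \<le> spectral_norm S"
proof -
  have "a \<bullet> (S *\<^sub>v a) \<le> vec_l2_norm a * vec_l2_norm (S *\<^sub>v a)"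
    using S a by (intro scalar_prod_le_l2_norms) auto
  also have "\<dots> \<le> 1 * spectral_norm S"
    using a vec_l2_norm_le_spectral_norm[OF S a] by (intro mult_mono) auto
  finally show ?thesis by simp
qed

text \<open>Carries the lower bound on the eigenvalues of \<Sigma> over to its spectral norm: a unit
  eigenvector has an image of norm |e|.\<close>

lemma eigenvalue_le_spectral_norm:
  assumes S: "S \<in> carrier_mat p p" and e: "eigenvalue S e"
  shows "e \<le> spectral_norm S"
proof -
  obtain v where v: "v \<in> carrier_vec p" "v \<noteq> 0\<^sub>v p" "S *\<^sub>v v = e \<cdot>\<^sub>v v"
    using e S by (auto simp: eigenvalue_def eigenvector_def)
  define u where "u = (1 / vec_l2_norm v) \<cdot>\<^sub>v v"
  have nz: "vec_l2_norm v \<noteq> 0" using v by (simp add: vec_l2_norm_eq_0_iff)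
  then have u: "u \<in> carrier_vec p" "vec_l2_norm u = 1"
    using v by (auto simp: u_def vec_l2_norm_smult)
  have "S *\<^sub>v u = e \<cdot>\<^sub>v u"
    using v mult_mat_vec[OF S v(1)] by (simp add: u_def smult_smult_assoc mult.commute)
  then have "vec_l2_norm (S *\<^sub>v u) = \<bar>e\<bar>" using u by (simp add: vec_l2_norm_smult)
  then show ?thesis using vec_l2_norm_le_spectral_norm[OF S u(1)] u(2) by simp
qed

subsection \<open>The mixture model\<close>

lemma mixture_mat_carrier [simp]: "mixture_mat p n y m1 m2 w \<in> carrier_mat p n"
  unfolding mixture_mat_def
  using mat_of_cols_carrier(1)[of p "map (\<lambda>i. y i \<cdot>\<^sub>v m1 + (1 - y i) \<cdot>\<^sub>v m2 + w i) [0..<n]"] by simp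

lemma mixture_mat_dim [simp]:
  "dim_row (mixture_mat p n y m1 m2 w) = p" "dim_col (mixture_mat p n y m1 m2 w) = n"
  using carrier_matD[OF mixture_mat_carrier] by auto

lemma mixture_mat_index:
  assumes "i < p" "j < n" "m2 \<in> carrier_vec p" "w j \<in> carrier_vec p"
  shows "mixture_mat p n y m1 m2 w $$ (i,j) = (y j \<cdot>\<^sub>v m1 + (1 - y j) \<cdot>\<^sub>v m2) $ i + w j $ i"
  using assms by (simp add: mixture_mat_def mat_of_cols_index)

lemma mixture_mat_decomp:
  assumes "m2 \<in> carrier_vec p" "\<And>j. j < n \<Longrightarrow> w j \<in> carrier_vec p"
  shows "mixture_mat p n y m1 m2 w = mixture_mat p n y m1 m2 (\<lambda>_. 0\<^sub>v p) + noise_mat p n w"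
proof (rule eq_matI)
  fix i j
  assume "i < dim_row (mixture_mat p n y m1 m2 (\<lambda>_. 0\<^sub>v p) + noise_mat p n w)"
    "j < dim_col (mixture_mat p n y m1 m2 (\<lambda>_. 0\<^sub>v p) + noise_mat p n w)"
  then have "i < p" "j < n" using carrier_matD[OF noise_mat_carrier[of p n w]] by auto
  then show "mixture_mat p n y m1 m2 w $$ (i,j)
      = (mixture_mat p n y m1 m2 (\<lambda>_. 0\<^sub>v p) + noise_mat p n w) $$ (i,j)"
    using assms carrier_matD[OF noise_mat_carrier[of p n w]]
    by (simp add: mixture_mat_index) (simp add: noise_mat_def mat_of_cols_index)
qed (use carrier_matD[OF noise_mat_carrier[of p n w]] in auto)

context prob_space
begin

lemma gaussian_vec_coordinate_mean:
  assumes w: "gaussian_vec M p S w" and i: "i < p"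
  shows "integrable M (\<lambda>\<omega>. w \<omega> $ i)" and "expectation (\<lambda>\<omega>. w \<omega> $ i) = 0"
proof -
  \<comment> \<open>The Gaussian law is specified through linear forms, and a coordinate is the
    linear form given by a unit vector.\<close>
  let ?e = "unit_vec p i :: real vec"
  have meas: "w \<in> M \<rightarrow>\<^sub>M vec_borel p"
    and law: "distr M borel (\<lambda>\<omega>. ?e \<bullet> w \<omega>) = centered_normal (?e \<bullet> (S *\<^sub>v ?e))"
    and var: "0 \<le> ?e \<bullet> (S *\<^sub>v ?e)"
    using w by (auto simp: gaussian_vec_def covariance_mat_def)
  have m: "(\<lambda>\<omega>. ?e \<bullet> w \<omega>) \<in> borel_measurable M"
    by (rule measurable_compose[OF meas measurable_scalar_prod]) simp
  have eq: "?e \<bullet> w \<omega> = w \<omega> $ i" if "\<omega> \<in> space M" for \<omega>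
    using measurable_space[OF meas that] i by simp
  have "integrable M (\<lambda>\<omega>. ?e \<bullet> w \<omega>)"
    using centered_normal_mean(1)[OF var] m unfolding law[symmetric]
    by (simp add: integrable_distr_eq)
  then show "integrable M (\<lambda>\<omega>. w \<omega> $ i)"
    by (rule Bochner_Integration.integrable_cong[THEN iffD1, rotated -1]) (simp_all add: eq)
  have "expectation (\<lambda>\<omega>. ?e \<bullet> w \<omega>) = 0"
    using centered_normal_mean(2)[OF var] m unfolding law[symmetric]
    by (simp add: integral_distr)
  then show "expectation (\<lambda>\<omega>. w \<omega> $ i) = 0"
    by (subst Bochner_Integration.integral_cong[OF refl eq[symmetric]]) auto
qed

lemma mat_expectation_mixture:
  assumes w: "iid_gaussian_vecs M p n S w" and m2: "m2 \<in> carrier_vec p"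
  shows "mat_expectation M p n (\<lambda>\<omega>. mixture_mat p n y m1 m2 (\<lambda>i. w i \<omega>))
    = mixture_mat p n y m1 m2 (\<lambda>_. 0\<^sub>v p)"
proof (rule eq_matI)
  fix i j
  assume "i < dim_row (mixture_mat p n y m1 m2 (\<lambda>_. 0\<^sub>v p))"
    "j < dim_col (mixture_mat p n y m1 m2 (\<lambda>_. 0\<^sub>v p))"
  then have ij: "i < p" "j < n" by auto
  let ?m = "(y j \<cdot>\<^sub>v m1 + (1 - y j) \<cdot>\<^sub>v m2) $ i"
  have gauss: "gaussian_vec M p S (w j)" using w ij by (simp add: iid_gaussian_vecs_def)
  then have meas: "w j \<in> M \<rightarrow>\<^sub>M vec_borel p" by (simp add: gaussian_vec_def)
  have "mixture_mat p n y m1 m2 (\<lambda>i. w i \<omega>) $$ (i,j) = ?m + w j \<omega> $ i" if "\<omega> \<in> space M" for \<omega>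
    using measurable_space[OF meas that] ij m2 by (simp add: mixture_mat_index del: index_add_vec)
  then have "expectation (\<lambda>\<omega>. mixture_mat p n y m1 m2 (\<lambda>i. w i \<omega>) $$ (i,j))
      = expectation (\<lambda>\<omega>. ?m + w j \<omega> $ i)"
    by (intro Bochner_Integration.integral_cong) auto
  also have "\<dots> = ?m"
    using gaussian_vec_coordinate_mean[OF gauss ij(1)] prob_space by (simp del: index_add_vec)
  also have "\<dots> = mixture_mat p n y m1 m2 (\<lambda>_. 0\<^sub>v p) $$ (i,j)"
    using ij m2 by (simp add: mixture_mat_index del: index_add_vec)
  finally show "mat_expectation M p n (\<lambda>\<omega>. mixture_mat p n y m1 m2 (\<lambda>i. w i \<omega>)) $$ (i,j)
      = mixture_mat p n y m1 m2 (\<lambda>_. 0\<^sub>v p) $$ (i,j)"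
    using ij by (simp add: mat_expectation_def)
qed (simp_all add: mat_expectation_def)

text \<open>The constant 14 is twice the level 7 of the Chernoff bound, the factor 2 coming from the
  passage to the net. At least two columns are required so that a second singular value is present
  in the list.\<close>

lemma mixture_singular_values_concentration:
  fixes y :: "nat \<Rightarrow> real" and m1 :: "real vec"
  assumes w: "iid_gaussian_vecs M p n S w" and m2: "m2 \<in> carrier_vec p"
    and pos: "0 < p" "2 \<le> n" and V: "0 < spectral_norm S"
  defines "X \<equiv> \<lambda>\<omega>. mixture_mat p n y m1 m2 (\<lambda>i. w i \<omega>)"
    and "K \<equiv> 14 * sqrt (spectral_norm S) * sqrt (real n + real p)"
  shows "\<exists>A\<in>events. prob A \<le> (1 / 2) ^ n \<and> (\<forall>\<omega>\<in>space M - A.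
    singular_value (X \<omega>) 1 \<le> singular_value (mat_expectation M p n X) 1 + K \<and>
    singular_value (mat_expectation M p n X) 2 \<le> singular_value (X \<omega>) 2 + K)"
proof -
  let ?V = "spectral_norm S"
  define k where "k = p + n"
  define T where "T = 7 * sqrt ?V * sqrt (real n + real p)"
  have n: "0 < n" using pos by simp
  have "covariance_mat p S" using w n by (auto simp: iid_gaussian_vecs_def gaussian_vec_def)
  then have S: "S \<in> carrier_mat p p" by (simp add: covariance_mat_def)
  have T: "0 < T" using V pos by (simp add: T_def)
  obtain A where A: "A \<in> events" "prob A \<le> 2 ^ (18 * (p + n)) * exp (- T\<^sup>2 / (2 * ?V))"
    "\<And>\<omega>. \<omega> \<in> space M - A \<Longrightarrow> singular_value (noise_mat p n (\<lambda>i. w i \<omega>)) 1 \<le> 2 * T"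
    using gaussian_noise_singular_value_tail[OF w pos(1) n V quadratic_form_le_spectral_norm[OF S] T]
    by blast
  \<comment> \<open>The level 7 makes the exponent 49 k / 2, at least 24 k. With e \<ge> 2 the tail
    is at most 2^(-24 k), against at most 2^(18 k) net pairs; the surplus 2^(-6 k) is below
    2^(-n).\<close>
  have "T\<^sup>2 / (2 * ?V) = 49 * real k / 2"
    using V by (simp add: T_def k_def power_mult_distrib)
  then have "exp (- T\<^sup>2 / (2 * ?V)) \<le> exp (- (real (24 * k)))" by simp
  also have "\<dots> = inverse (exp 1 ^ (24 * k))" by (simp add: exp_minus flip: exp_of_nat_mult)
  also have "\<dots> \<le> inverse (2 ^ (24 * k))"
    using exp_ge_add_one_self[of 1] by (intro le_imp_inverse_le power_mono) auto
  finally have "2 ^ (18 * k) * exp (- T\<^sup>2 / (2 * ?V)) \<le> 2 ^ (18 * k) * inverse (2 ^ (24 * k))"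
    by (rule mult_left_mono) simp
  also have "2 ^ (18 * k) * inverse (2 ^ (24 * k)) = (1 / 2 :: real) ^ (6 * k)"
  proof -
    have "24 * k = 18 * k + 6 * k" by simp
    then have "(2 :: real) ^ (24 * k) = 2 ^ (18 * k) * 2 ^ (6 * k)" by (simp only: power_add)
    moreover have "a * inverse (a * b) = inverse b" if "a \<noteq> 0" for a b :: real
      using that by simp
    ultimately show ?thesis by (simp only: power_one_over inverse_eq_divide) simp
  qed
  also have "\<dots> \<le> (1 / 2) ^ n" by (intro power_decreasing) (auto simp: k_def)
  finally have "prob A \<le> (1 / 2) ^ n" using A(2) by (simp add: k_def)
  moreover have "singular_value (X \<omega>) 1 \<le> singular_value (mat_expectation M p n X) 1 + K \<and>
    singular_value (mat_expectation M p n X) 2 \<le> singular_value (X \<omega>) 2 + K"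
    if \<omega>: "\<omega> \<in> space M - A" for \<omega>
  proof -
    let ?E = "mixture_mat p n y m1 m2 (\<lambda>_. 0\<^sub>v p)" and ?W = "noise_mat p n (\<lambda>i. w i \<omega>)"
    have E: "mat_expectation M p n X = ?E"
      unfolding X_def by (rule mat_expectation_mixture[OF w m2])
    have "w i \<omega> \<in> carrier_vec p" if "i < n" for i
    proof -
      have "w i \<in> M \<rightarrow>\<^sub>M vec_borel p"
        using w that by (simp add: iid_gaussian_vecs_def gaussian_vec_def)
      then show ?thesis using \<omega> measurable_space[of "w i" M "vec_borel p" \<omega>] by simp
    qed
    then have X: "X \<omega> = ?E + ?W" unfolding X_def by (rule mixture_mat_decomp[OF m2])
    have "singular_value ?W 1 \<le> K" using A(3)[OF \<omega>] by (simp add: T_def K_def)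
    then show ?thesis
      unfolding E X
      using singular_value_1_perturbation[OF mixture_mat_carrier noise_mat_carrier n,
          of p y m1 m2 "\<lambda>_. 0\<^sub>v p" "\<lambda>i. w i \<omega>"]
        singular_value_2_perturbation[OF mixture_mat_carrier noise_mat_carrier pos(2),
          of p y m1 m2 "\<lambda>_. 0\<^sub>v p" "\<lambda>i. w i \<omega>"]
      by linarith
  qed
  ultimately show ?thesis using A(1) by blast
qed

end

section \<open>From perturbation bounds to the ratio\<close>

text \<open>The excess t1 / t2 - 1 equals (t1 - t2) / t2. The numerator is at most r d2 + 2 K s.
  Since r \<le> 1 gives d1 \<le> 2 d2, the noise K s \<le> d1 / 8 is at most d2 / 4, so the
  denominator is at least 3/4 d2.\<close>

lemma singular_value_ratio_bound:
  fixes d1 d2 t1 t2 s r K :: real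
  assumes d2: "0 < d2" and ratio: "d1 / d2 \<le> 1 + r" and r: "0 < r" "r \<le> 1"
    and s: "0 < s" and K: "0 < K" "8 * (K * s) \<le> d1"
    and t: "t1 \<le> d1 + K * s" "d2 \<le> t2 + K * s"
  shows "t2 \<noteq> 0" and "t1 / t2 < 1 + (2 + 8 * K) * (r + s / d1)"
proof -
  have d1: "0 < d1" using K s mult_pos_pos[of K s] by linarith
  have d12: "d1 \<le> d2 + r * d2" using ratio d2 by (simp add: divide_le_eq distrib_right)
  have "r * d2 \<le> 1 * d2" using r d2 by (intro mult_right_mono) auto
  then have d1_le: "d1 \<le> 2 * d2" using d12 by simp
  then have t2: "3 / 4 * d2 \<le> t2" using K t by linarith
  then have t2_pos: "0 < t2" using d2 by linarith
  then show "t2 \<noteq> 0" by simp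
  \<comment> \<open>The noise is to be measured relative to \<open>d1\<close>, while the denominator
    is controlled by \<open>d2\<close>; the exchange costs a factor 2.\<close>
  have "1 / 2 \<le> d2 / d1" using d1 d1_le by (simp add: field_simps)
  then have "K * s * (1 / 2) \<le> K * s * (d2 / d1)"
    using K s by (intro mult_left_mono) auto
  moreover have "0 < r * d2" "0 < K * s" "0 \<le> 8 * K * r" "0 \<le> 2 * (s / d1)"
    using r d2 K s d1 by auto
  \<comment> \<open>After multiplication by 3/4 d2 the coefficients 2 and 8 K give 3/2 r d2 and at
    least 3 K s, which exceed r d2 and 2 K s. The margin makes the inequality strict, as required to
    contradict the non-strict event.\<close>
  ultimately have "r * d2 + 2 * (K * s) < (2 * r + 8 * K * (s / d1)) * (3 / 4 * d2)"
    by (simp add: algebra_simps)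
  also have "\<dots> \<le> ((2 + 8 * K) * (r + s / d1)) * t2"
    using t2 d2 r K s d1 by (intro mult_mono) (auto simp: algebra_simps)
  finally have "t1 - t2 < ((2 + 8 * K) * (r + s / d1)) * t2"
    using t d12 by linarith
  then show "t1 / t2 < 1 + (2 + 8 * K) * (r + s / d1)"
    using t2_pos by (simp add: divide_less_eq distrib_right)
qed

text \<open>Division by zero yields 0 in HOL, whereas a ratio with vanishing second singular value
  is meant to be infinite. Therefore \<open>0 < d2 n\<close> accompanies the ratio hypothesis, and
  \<open>t2 n \<omega> = 0\<close> is counted as part of the event.\<close>

theorem theorem2:
  fixes M :: "nat \<Rightarrow> 'a measure"
    and p :: "nat \<Rightarrow> nat"
    and Y :: "nat \<Rightarrow> nat \<Rightarrow> real"
    and \<mu>1 \<mu>2 :: "nat \<Rightarrow> real vec"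
    and \<Sigma> :: "nat \<Rightarrow> real mat"
    and w :: "nat \<Rightarrow> nat \<Rightarrow> 'a \<Rightarrow> real vec"
    and X :: "nat \<Rightarrow> 'a \<Rightarrow> real mat"
    and \<sigma> d1 d2 :: "nat \<Rightarrow> real"
    and t1 t2 :: "nat \<Rightarrow> 'a \<Rightarrow> real"
    and lo hi C0 c :: real
    and n0 :: nat
  assumes prob: "\<And>n. n \<ge> 1 \<Longrightarrow> prob_space (M n)"
    and labels: "\<And>n i. n \<ge> 1 \<Longrightarrow> i < n \<Longrightarrow> Y n i \<in> {0, 1}"
    and mu1_dim: "\<And>n. n \<ge> 1 \<Longrightarrow> \<mu>1 n \<in> carrier_vec (p n)"
    and mu2_dim: "\<And>n. n \<ge> 1 \<Longrightarrow> \<mu>2 n \<in> carrier_vec (p n)"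
    and mu_neq: "\<And>n. n \<ge> 1 \<Longrightarrow> \<mu>1 n \<noteq> \<mu>2 n"
    and mu2_nz: "\<And>n. n \<ge> 1 \<Longrightarrow> \<mu>2 n \<noteq> 0\<^sub>v (p n)"
    and noise: "\<And>n. n \<ge> 1 \<Longrightarrow> iid_gaussian_vecs (M n) (p n) n (\<Sigma> n) (w n)"
    and X_eq: "\<And>n \<omega>. X n \<omega> = mixture_mat (p n) n (Y n) (\<mu>1 n) (\<mu>2 n) (\<lambda>i. w n i \<omega>)"
    and sigma_eq: "\<And>n. \<sigma> n = sqrt ((spectral_norm (\<Sigma> n))\<^sup>2 * (real n + real (p n)))"
    and d1_eq: "\<And>n. d1 n = singular_value (mat_expectation (M n) (p n) n (X n)) 1"
    and d2_eq: "\<And>n. d2 n = singular_value (mat_expectation (M n) (p n) n (X n)) 2"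
    and t1_eq: "\<And>n \<omega>. t1 n \<omega> = singular_value (X n \<omega>) 1"
    and t2_eq: "\<And>n \<omega>. t2 n \<omega> = singular_value (X n \<omega>) 2"
    and eig_bounds: "0 < lo" "\<And>n e. n \<ge> 1 \<Longrightarrow> eigenvalue (\<Sigma> n) e \<Longrightarrow> lo \<le> e \<and> e \<le> hi"
    and C0_pos: "0 < C0"
    and p_growth: "\<And>n. n \<ge> 1 \<Longrightarrow>
        real n powr (1 / C0) \<le> real (p n) \<and> real (p n) \<le> real n powr C0"
    and d1_sigma: "filterlim (\<lambda>n. d1 n / \<sigma> n) at_top sequentially"
    and c_pos: "0 < c"
    and n0_pos: "0 < n0"
    and d_ratio: "\<And>n. n \<ge> n0 \<Longrightarrow> 0 < d2 n \<and> d1 n / d2 n \<le> 1 + real n powr (- c)"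
  shows "\<exists>C>0. (\<lambda>n. measure (M n) {\<omega> \<in> space (M n).
            t2 n \<omega> = 0 \<or>
            t1 n \<omega> / t2 n \<omega> \<ge> 1 + C * (1 / real n powr c + \<sigma> n / d1 n)})
         \<longlonglongrightarrow> 0"
proof -
  \<comment> \<open>Chosen so that 14 sqrt V \<le> K V whenever V \<ge> lo, where V is the spectral
    norm of \<Sigma>; this expresses the noise bound as a multiple of \<sigma>.\<close>
  define K where "K = 14 / sqrt lo"
  define C where "C = 2 + 8 * K"
  let ?F = "\<lambda>n. {\<omega> \<in> space (M n). t2 n \<omega> = 0 \<or>
    t1 n \<omega> / t2 n \<omega> \<ge> 1 + C * (1 / real n powr c + \<sigma> n / d1 n)}"
  have K: "0 < K" using eig_bounds(1) by (simp add: K_def)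
  have bound: "measure (M n) (?F n) \<le> (1 / 2) ^ n"
    if n: "n \<ge> 2" "n \<ge> n0" and large: "8 * K \<le> d1 n / \<sigma> n" for n
  proof -
    have n1: "1 \<le> n" using n by simp
    interpret prob_space "M n" by (rule prob[OF n1])
    let ?V = "spectral_norm (\<Sigma> n)"
    have "0 < real n powr (1 / C0)" using n1 by simp
    then have p: "0 < p n" using p_growth[OF n1] by linarith
    have "covariance_mat (p n) (\<Sigma> n)"
      using noise[OF n1] n1 by (auto simp: iid_gaussian_vecs_def gaussian_vec_def)
    then have S: "\<Sigma> n \<in> carrier_mat (p n) (p n)" "transpose_mat (\<Sigma> n) = \<Sigma> n"
      by (auto simp: covariance_mat_def)
    \<comment> \<open>The eigenvalue bound reaches the spectral norm only through an actual
      eigenvalue. One exists because the growth condition on \<open>p\<close> excludes dimension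
      0.\<close>
    obtain e where e: "eigenvalue (\<Sigma> n) e" using symmetric_real_eigenvalue[OF S p] by blast
    have V: "lo \<le> ?V"
      using eig_bounds(2)[OF n1 e] eigenvalue_le_spectral_norm[OF S(1) e] by simp
    then have V_pos: "0 < ?V" using eig_bounds(1) by simp
    have \<sigma>: "\<sigma> n = ?V * sqrt (real n + real (p n))"
      unfolding sigma_eq using V_pos by (simp add: real_sqrt_mult)
    then have \<sigma>_pos: "0 < \<sigma> n" using V_pos p by simp
    have "sqrt ?V * sqrt lo \<le> sqrt ?V * sqrt ?V" using V V_pos by (intro mult_left_mono) auto
    also have "\<dots> = ?V" using V_pos by simp
    finally have "sqrt ?V \<le> ?V / sqrt lo" using eig_bounds(1) by (simp add: pos_le_divide_eq)
    then have "14 * sqrt ?V * sqrt (real n + real (p n))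
        \<le> 14 * (?V / sqrt lo) * sqrt (real n + real (p n))"
      by (intro mult_right_mono mult_left_mono) auto
    also have "\<dots> = K * \<sigma> n" by (simp add: K_def \<sigma>)
    finally have noise_le: "14 * sqrt ?V * sqrt (real n + real (p n)) \<le> K * \<sigma> n" .
    have X_fun: "X n = (\<lambda>\<omega>. mixture_mat (p n) n (Y n) (\<mu>1 n) (\<mu>2 n) (\<lambda>i. w n i \<omega>))"
      by (rule ext) (rule X_eq)
    obtain A where A: "A \<in> events" "prob A \<le> (1 / 2) ^ n"
      and tA: "\<And>\<omega>. \<omega> \<in> space (M n) - A \<Longrightarrow> t1 n \<omega> \<le> d1 n + K * \<sigma> n \<and> d2 n \<le> t2 n \<omega> + K * \<sigma> n"
    proof -
      obtain A where A: "A \<in> events" "prob A \<le> (1 / 2) ^ n"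
        "\<And>\<omega>. \<omega> \<in> space (M n) - A \<Longrightarrow>
          singular_value (X n \<omega>) 1
            \<le> singular_value (mat_expectation (M n) (p n) n (X n)) 1
              + 14 * sqrt ?V * sqrt (real n + real (p n)) \<and>
          singular_value (mat_expectation (M n) (p n) n (X n)) 2
            \<le> singular_value (X n \<omega>) 2 + 14 * sqrt ?V * sqrt (real n + real (p n))"
        using mixture_singular_values_concentration[OF noise[OF n1] mu2_dim[OF n1] p n(1) V_pos,
            of "Y n" "\<mu>1 n"]
        unfolding X_fun[symmetric] X_eq[symmetric] by blast
      show ?thesis
      proof (rule that[OF A(1,2)])
        fix \<omega> assume "\<omega> \<in> space (M n) - A"
        from A(3)[OF this] noise_le
        show "t1 n \<omega> \<le> d1 n + K * \<sigma> n \<and> d2 n \<le> t2 n \<omega> + K * \<sigma> n"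
          unfolding t1_eq t2_eq d1_eq d2_eq by linarith
      qed
    qed
    have r_eq: "1 / real n powr c = real n powr (- c)" by (simp add: powr_minus_divide)
    have r: "0 < real n powr (- c)" "real n powr (- c) \<le> 1"
      using n1 c_pos by (auto simp: powr_minus_divide divide_le_eq ge_one_powr_ge_zero)
    have "8 * (K * \<sigma> n) \<le> d1 n" using large \<sigma>_pos by (simp add: pos_le_divide_eq mult.assoc)
    note ratio = singular_value_ratio_bound[OF _ _ r \<sigma>_pos K this]
    \<comment> \<open>Monotonicity of the measure is applied with the measurable set
      \<open>A\<close> as the larger one.\<close>
    have "?F n \<subseteq> A"
    proof
      fix \<omega> assume \<omega>: "\<omega> \<in> ?F n"
      show "\<omega> \<in> A"
      proof (rule ccontr)
        assume "\<omega> \<notin> A"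
        then have t: "t1 n \<omega> \<le> d1 n + K * \<sigma> n" "d2 n \<le> t2 n \<omega> + K * \<sigma> n"
          using tA[of \<omega>] \<omega> by auto
        show False
          using ratio[OF _ _ t] d_ratio[OF n(2)] \<omega> by (auto simp: r_eq C_def)
      qed
    qed
    then show ?thesis using finite_measure_mono[OF _ A(1)] A(2) by (meson order_trans)
  qed
  have "eventually (\<lambda>n. 8 * K \<le> d1 n / \<sigma> n) sequentially"
    using d1_sigma by (simp add: filterlim_at_top)
  then have "eventually (\<lambda>n. measure (M n) (?F n) \<le> (1 / 2) ^ n) sequentially"
    using eventually_ge_at_top[of 2] eventually_ge_at_top[of n0]
    by eventually_elim (rule bound)
  then have "(\<lambda>n. measure (M n) (?F n)) \<longlonglongrightarrow> 0"
    by (intro tendsto_sandwich[OF _ _ tendsto_const LIMSEQ_power_zero[of "1 / 2 :: real"]]) auto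
  moreover have "0 < C" using K by (simp add: C_def)
  ultimately show ?thesis by blast
qed

end
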